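(* Let $\mathit{Tam}(G)$ denote the category of Tambara functors on $G$ and let $\mathit{Tam}^{\mathrm{MRC}}_{(G)}\subseteq\mathit{Tam}(G)$ denote the full subcategory of Tambara functors satisfying (MRC). For each Tambara functor $T$ put $T_{\mathrm{MRC}}=T/\mathscr{I}^T_{(0)}$. Then: (1) For any $T\in\mathrm{Ob}(\mathit{Tam}(G))$, we have $T_{\mathrm{MRC}}\in\mathrm{Ob}(\mathit{Tam}^{\mathrm{MRC}}_{(G)})$. (2) The correspondence $T\mapsto T_{\mathrm{MRC}}$ gives a functor $(\ )_{\mathrm{MRC}}\colon\mathit{Tam}(G)\rightarrow\mathit{Tam}^{\mathrm{MRC}}_{(G)}$. (3) The functor in (2) is left adjoint to the inclusion $\mathit{Tam}^{\mathrm{MRC}}_{(G)}\hookrightarrow\mathit{Tam}(G)$.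
   Context: $G$ is a fixed finite group, $e$ denotes its unit and also the trivial subgroup; ${}_G\mathrm{set}$ is the category of finite $G$-sets and $G$-equivariant maps. Rings and monoids are commutative with unit. Semi-Mackey functor $M=(M^*,M_* )$ on $G$: a contravariant functor $M^*$ and a covariant functor $M_*$ from ${}_G\mathrm{set}$ to sets with $M^*(X)=M_*(X)=:M(X)$ such that (a) $M^*$ sends finite coproducts to products; (b) for every pull-back square with $f\colon X\to Y$, $\eta\colon Y'\to Y$, $\xi\colon X'\to X$, $f'\colon X'\to Y'$ one has $M^*(\eta)M_*(f)=M_*(f')M^*(\xi)$. Each $M(X)$ is then a commutative monoid (operation $M_*(\nabla)$, $\nabla\colon X\amalg X\to X$ the folding map). It is a Mackey functor if all $M(X)$ are abelian groups. Exponential diagram of $X\overset{p}{\leftarrow}A$ and $f\colon X\to Y$: up to isomorphism, $\Pi=\{(y,\sigma)\mid y\in Y,\ \sigma\colon f^{-1}(y)\to A \text{ a map of sets},\ p\circ\sigma=\mathrm{id}\}$ with $G$-action by conjugating $\sigma$, $\pi\colon\Pi\to Y$, $\pi(y,\sigma)=y$, $Z=X\times_Y\Pi$, $\rho\colon Z\to\Pi$ the projection, $\lambda\colon Z\to A$, $\lambda(x,(y,\sigma))=\sigma(x)$. Tambara functor $T=(T^*,T_+,T_\bullet)$ on $G$: $T^*$ contravariant, $T_+,T_\bullet$ covariant functors ${}_G\mathrm{set}\to\mathrm{Set}$ such that $(T^*,T_+)$ is a Mackey functor, $(T^*,T_\bullet)$ is a semi-Mackey functor, and $T_\bullet(f)T_+(p)=T_+(\pi)T_\bullet(\rho)T^*(\lambda)$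 for every exponential diagram. Each $T(X)$ is a ring. For $f\colon X\to Y$ write $f^*=T^*(f)$ (a ring homomorphism), $f_+=T_+(f)$ (additive), $f_\bullet=T_\bullet(f)$ (multiplicative). A morphism $\varphi\colon T\to S$ is a family of ring homomorphisms $\varphi_X\colon T(X)\to S(X)$ commuting with all $f^*,f_+,f_\bullet$. An ideal $\mathscr{I}$ of $T$ is a family of ideals $\mathscr{I}(X)\subseteq T(X)$ such that for every $f\colon X\to Y$: $f^*(\mathscr{I}(Y))\subseteq\mathscr{I}(X)$, $f_+(\mathscr{I}(X))\subseteq\mathscr{I}(Y)$, $f_\bullet(\mathscr{I}(X))\subseteq f_\bullet(0)+\mathscr{I}(Y)$. $T/\mathscr{I}=\{T(X)/\mathscr{I}(X)\}_X$ is a Tambara functor with structure morphisms induced from $T$. The ideal $\mathscr{I}^T_{(0)}\subseteq T$ is given by $\mathscr{I}^T_{(0)}(X)=\bigcap_{\gamma}(\gamma^* )^{-1}(0)$, where $\gamma$ runs over all $G$-maps $G/e\to X$ and $\gamma^*\colon T(X)\to T(G/e)$. $T$ satisfies (MRC) (monomorphic restriction condition) if for every $G$-map $f\colon X\to Y$ between transitive finite $G$-sets, $f^*\colon T(Y)\to T(X)$ is injective. *)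

theory Defs
  imports
    "HOL-Algebra.Group_Action"
    "HOL-Algebra.QuotRing"
    "HOL-Algebra.RingHom"
    "HOL-Library.Infinite_Typeclass"
begin

section \<open>Finite \<open>G\<close>-sets\<close>

text \<open>
  The finite \<open>G\<close>-sets are those whose points lie in a type \<open>'x\<close>. When \<open>'x\<close> is infinite,
  every finite \<open>G\<close>-set is isomorphic to one of these, so that they form a category equivalent to
  that of all finite \<open>G\<close>-sets. Coproducts, pull-backs, exponential diagrams and \<open>G/e\<close> are
  therefore treated up to isomorphism.
\<close>

record ('g, 'x) gset =
  pts :: "'x set"
  act :: "'g \<Rightarrow> 'x \<Rightarrow> 'x"

definition fin_gset :: "('g, 'b) monoid_scheme \<Rightarrow> ('g, 'x) gset \<Rightarrow> bool" where
  "fin_gset G X \<longleftrightarrow> group_action G (pts X) (act X) \<and> finite (pts X)"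

text \<open>The library's \<^const>\<open>transitive_action\<close> does not exclude the empty set.\<close>

definition transitive_gset :: "('g, 'b) monoid_scheme \<Rightarrow> ('g, 'x) gset \<Rightarrow> bool" where
  "transitive_gset G X \<longleftrightarrow>
     fin_gset G X \<and> transitive_action G (pts X) (act X) \<and> pts X \<noteq> {}"

definition gmap ::
    "('g, 'b) monoid_scheme \<Rightarrow> ('g, 'x) gset \<Rightarrow> ('g, 'y) gset \<Rightarrow> ('x \<Rightarrow> 'y) set" where
  "gmap G X Y =
     {f \<in> pts X \<rightarrow>\<^sub>E pts Y. \<forall>g\<in>carrier G. \<forall>x\<in>pts X. f (act X g x) = act Y g (f x)}"

definition giso ::
    "('g, 'b) monoid_scheme \<Rightarrow> ('g, 'x) gset \<Rightarrow> ('g, 'y) gset \<Rightarrow> ('x \<Rightarrow> 'y) set" where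
  "giso G X Y = {f \<in> gmap G X Y. bij_betw f (pts X) (pts Y)}"

definition gid :: "('g, 'x) gset \<Rightarrow> 'x \<Rightarrow> 'x" where
  "gid X = (\<lambda>x\<in>pts X. x)"

definition gempty :: "('g, 'x) gset" where
  "gempty = \<lparr>pts = {}, act = (\<lambda>_ _. undefined)\<rparr>"

text \<open>\<open>G/e\<close> is \<open>G\<close> with its action by left translation.\<close>

definition regular_gset :: "('g, 'b) monoid_scheme \<Rightarrow> ('g, 'g) gset" where
  "regular_gset G = \<lparr>pts = carrier G, act = (\<lambda>g. \<lambda>h\<in>carrier G. g \<otimes>\<^bsub>G\<^esub> h)\<rparr>"

definition is_G_mod_e :: "('g, 'b) monoid_scheme \<Rightarrow> ('g, 'x) gset \<Rightarrow> bool" where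
  "is_G_mod_e G E \<longleftrightarrow> fin_gset G E \<and> giso G E (regular_gset G) \<noteq> {}"

text \<open>\<open>W\<close> is the disjoint union of \<open>X\<close> and \<open>Y\<close> along \<open>i\<close> and \<open>j\<close>.\<close>

definition gcoproduct ::
    "('g, 'b) monoid_scheme \<Rightarrow> ('g, 'x) gset \<Rightarrow> ('g, 'x) gset \<Rightarrow> ('g, 'x) gset
      \<Rightarrow> ('x \<Rightarrow> 'x) \<Rightarrow> ('x \<Rightarrow> 'x) \<Rightarrow> bool" where
  "gcoproduct G X Y W i j \<longleftrightarrow>
     fin_gset G X \<and> fin_gset G Y \<and> fin_gset G W \<and> i \<in> gmap G X W \<and> j \<in> gmap G Y W \<and>
     inj_on i (pts X) \<and> inj_on j (pts Y) \<and>
     i ` pts X \<inter> j ` pts Y = {} \<and> i ` pts X \<union> j ` pts Y = pts W"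

text \<open>The square with \<open>f : X \<rightarrow> Y\<close>, \<open>\<eta> : Y' \<rightarrow> Y\<close>, \<open>\<xi> : X' \<rightarrow> X\<close>, \<open>f' : X' \<rightarrow> Y'\<close>.\<close>

definition gpullback ::
    "('g, 'b) monoid_scheme \<Rightarrow> ('g, 'x) gset \<Rightarrow> ('g, 'x) gset \<Rightarrow> ('g, 'x) gset \<Rightarrow> ('g, 'x) gset
      \<Rightarrow> ('x \<Rightarrow> 'x) \<Rightarrow> ('x \<Rightarrow> 'x) \<Rightarrow> ('x \<Rightarrow> 'x) \<Rightarrow> ('x \<Rightarrow> 'x) \<Rightarrow> bool" where
  "gpullback G X' X Y' Y f' f \<xi> \<eta> \<longleftrightarrow>
     fin_gset G X' \<and> fin_gset G X \<and> fin_gset G Y' \<and> fin_gset G Y \<and>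
     f' \<in> gmap G X' Y' \<and> f \<in> gmap G X Y \<and> \<xi> \<in> gmap G X' X \<and> \<eta> \<in> gmap G Y' Y \<and>
     bij_betw (\<lambda>x'. (\<xi> x', f' x')) (pts X') {(x, y'). x \<in> pts X \<and> y' \<in> pts Y' \<and> f x = \<eta> y'}"

text \<open>The sets \<open>\<Pi>\<close> and \<open>Z = X \<times>\<^sub>Y \<Pi>\<close> of the exponential diagram of \<open>p : A \<rightarrow> X\<close> and \<open>f : X \<rightarrow> Y\<close>.\<close>

definition exp_Pi ::
    "('g, 'b) monoid_scheme \<Rightarrow> ('g, 'x) gset \<Rightarrow> ('g, 'x) gset \<Rightarrow> ('g, 'x) gset
      \<Rightarrow> ('x \<Rightarrow> 'x) \<Rightarrow> ('x \<Rightarrow> 'x) \<Rightarrow> ('g, 'x \<times> ('x \<Rightarrow> 'x)) gset" where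
  "exp_Pi G A X Y p f =
     (let fibre = (\<lambda>y. {x \<in> pts X. f x = y});
          P = {(y, \<sigma>). y \<in> pts Y \<and> \<sigma> \<in> fibre y \<rightarrow>\<^sub>E pts A \<and> (\<forall>x\<in>fibre y. p (\<sigma> x) = x)}
      in \<lparr>pts = P,
          act = (\<lambda>g. \<lambda>(y, \<sigma>)\<in>P.
            (act Y g y, \<lambda>x\<in>fibre (act Y g y). act A g (\<sigma> (act X (inv\<^bsub>G\<^esub> g) x))))\<rparr>)"

definition exp_Z ::
    "('g, 'b) monoid_scheme \<Rightarrow> ('g, 'x) gset \<Rightarrow> ('g, 'x) gset \<Rightarrow> ('g, 'x) gset
      \<Rightarrow> ('x \<Rightarrow> 'x) \<Rightarrow> ('x \<Rightarrow> 'x) \<Rightarrow> ('g, 'x \<times> ('x \<times> ('x \<Rightarrow> 'x))) gset" where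
  "exp_Z G A X Y p f =
     (let Q = exp_Pi G A X Y p f;
          P = {(x, q). x \<in> pts X \<and> q \<in> pts Q \<and> f x = fst q}
      in \<lparr>pts = P, act = (\<lambda>g. \<lambda>(x, q)\<in>P. (act X g x, act Q g q))\<rparr>)"

text \<open>
  \<open>A \<leftarrow> Z \<rightarrow> Q \<rightarrow> Y\<close> (by \<open>l\<close>, \<open>r\<close>, \<open>q\<close>) is isomorphic to the above model, in which
  the maps are \<open>\<lambda>(x, (y, \<sigma>)) = \<sigma> x\<close>, \<open>\<rho>(x, (y, \<sigma>)) = (y, \<sigma>)\<close> and \<open>\<pi>(y, \<sigma>) = y\<close>.
\<close>

definition exponential_diagram ::
    "('g, 'b) monoid_scheme \<Rightarrow> ('g, 'x) gset \<Rightarrow> ('g, 'x) gset \<Rightarrow> ('g, 'x) gset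
      \<Rightarrow> ('x \<Rightarrow> 'x) \<Rightarrow> ('x \<Rightarrow> 'x) \<Rightarrow> ('g, 'x) gset \<Rightarrow> ('g, 'x) gset
      \<Rightarrow> ('x \<Rightarrow> 'x) \<Rightarrow> ('x \<Rightarrow> 'x) \<Rightarrow> ('x \<Rightarrow> 'x) \<Rightarrow> bool" where
  "exponential_diagram G A X Y p f Z Q l r q \<longleftrightarrow>
     fin_gset G A \<and> fin_gset G X \<and> fin_gset G Y \<and> fin_gset G Z \<and> fin_gset G Q \<and>
     p \<in> gmap G A X \<and> f \<in> gmap G X Y \<and>
     l \<in> gmap G Z A \<and> r \<in> gmap G Z Q \<and> q \<in> gmap G Q Y \<and>
     (\<exists>\<alpha> \<in> giso G Z (exp_Z G A X Y p f). \<exists>\<beta> \<in> giso G Q (exp_Pi G A X Y p f).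
        (\<forall>z\<in>pts Z. l z = snd (snd (\<alpha> z)) (fst (\<alpha> z)) \<and> \<beta> (r z) = snd (\<alpha> z)) \<and>
        (\<forall>w\<in>pts Q. q w = fst (\<beta> w)))"

section \<open>Mackey functors\<close>

locale semi_mackey = group G
  for G :: "('g, 'b) monoid_scheme" (structure) +
  fixes M :: "('g, 'x) gset \<Rightarrow> 'u set"
    and pull :: "('g, 'x) gset \<Rightarrow> ('g, 'x) gset \<Rightarrow> ('x \<Rightarrow> 'x) \<Rightarrow> 'u \<Rightarrow> 'u"
    and push :: "('g, 'x) gset \<Rightarrow> ('g, 'x) gset \<Rightarrow> ('x \<Rightarrow> 'x) \<Rightarrow> 'u \<Rightarrow> 'u"
  assumes pull_closed:
      "\<lbrakk>fin_gset G X; fin_gset G Y; f \<in> gmap G X Y\<rbrakk> \<Longrightarrow> pull X Y f \<in> M Y \<rightarrow> M X"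
    and push_closed:
      "\<lbrakk>fin_gset G X; fin_gset G Y; f \<in> gmap G X Y\<rbrakk> \<Longrightarrow> push X Y f \<in> M X \<rightarrow> M Y"
    and pull_id: "\<lbrakk>fin_gset G X; a \<in> M X\<rbrakk> \<Longrightarrow> pull X X (gid X) a = a"
    and push_id: "\<lbrakk>fin_gset G X; a \<in> M X\<rbrakk> \<Longrightarrow> push X X (gid X) a = a"
    and pull_comp:
      "\<lbrakk>fin_gset G X; fin_gset G Y; fin_gset G Z; f \<in> gmap G X Y; h \<in> gmap G Y Z; a \<in> M Z\<rbrakk>
        \<Longrightarrow> pull X Z (compose (pts X) h f) a = pull X Y f (pull Y Z h a)"
    and push_comp:
      "\<lbrakk>fin_gset G X; fin_gset G Y; fin_gset G Z; f \<in> gmap G X Y; h \<in> gmap G Y Z; a \<in> M X\<rbrakk>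
        \<Longrightarrow> push X Z (compose (pts X) h f) a = push Y Z h (push X Y f a)"
    and empty_to_point: "\<lbrakk>fin_gset G X; pts X = {}\<rbrakk> \<Longrightarrow> \<exists>!a. a \<in> M X"
    and coproduct_to_product:
      "gcoproduct G X Y W i j
        \<Longrightarrow> bij_betw (\<lambda>a. (pull X W i a, pull Y W j a)) (M W) (M X \<times> M Y)"
    and base_change:
      "\<lbrakk>gpullback G X' X Y' Y f' f \<xi> \<eta>; a \<in> M X\<rbrakk>
        \<Longrightarrow> pull Y' Y \<eta> (push X Y f a) = push X' Y' f' (pull X' X \<xi> a)"

text \<open>
  The operation on \<open>M X\<close> is \<open>M X \<times> M X \<cong> M (X \<amalg> X) \<rightarrow> M X\<close>, the last map being induced by
  the folding map; the result does not depend on the choice of \<open>X \<amalg> X\<close>. The unit is the image of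
  the unique element of \<open>M \<emptyset>\<close>.
\<close>

definition mackey_monoid ::
    "('g, 'b) monoid_scheme \<Rightarrow> (('g, 'x) gset \<Rightarrow> 'u set)
      \<Rightarrow> (('g, 'x) gset \<Rightarrow> ('g, 'x) gset \<Rightarrow> ('x \<Rightarrow> 'x) \<Rightarrow> 'u \<Rightarrow> 'u)
      \<Rightarrow> (('g, 'x) gset \<Rightarrow> ('g, 'x) gset \<Rightarrow> ('x \<Rightarrow> 'x) \<Rightarrow> 'u \<Rightarrow> 'u)
      \<Rightarrow> ('g, 'x) gset \<Rightarrow> 'u monoid" where
  "mackey_monoid G M pull push X =
     \<lparr>carrier = M X,
      mult = (\<lambda>a b. THE c. \<exists>W i j fold z.
        gcoproduct G X X W i j \<and>
        fold \<in> gmap G W X \<and> (\<forall>x\<in>pts X. fold (i x) = x \<and> fold (j x) = x) \<and>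
        z \<in> M W \<and> pull X W i z = a \<and> pull X W j z = b \<and> c = push W X fold z),
      one = push gempty X (\<lambda>_. undefined) (THE z. z \<in> M gempty)\<rparr>"

locale mackey = semi_mackey +
  assumes abelian: "fin_gset G X \<Longrightarrow> comm_group (mackey_monoid G M pull push X)"

section \<open>Tambara functors\<close>

text \<open>The fields are the sets \<open>T X\<close> and the maps \<open>f\<^sup>*\<close>, \<open>f\<^sub>+\<close>, \<open>f\<^sub>\<bullet>\<close> for \<open>f : X \<rightarrow> Y\<close>.\<close>

record ('g, 'x, 'u) tambara =
  val :: "('g, 'x) gset \<Rightarrow> 'u set"
  res :: "('g, 'x) gset \<Rightarrow> ('g, 'x) gset \<Rightarrow> ('x \<Rightarrow> 'x) \<Rightarrow> 'u \<Rightarrow> 'u"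
  trn :: "('g, 'x) gset \<Rightarrow> ('g, 'x) gset \<Rightarrow> ('x \<Rightarrow> 'x) \<Rightarrow> 'u \<Rightarrow> 'u"
  nrm :: "('g, 'x) gset \<Rightarrow> ('g, 'x) gset \<Rightarrow> ('x \<Rightarrow> 'x) \<Rightarrow> 'u \<Rightarrow> 'u"

definition tambara_functor ::
    "('g, 'b) monoid_scheme \<Rightarrow> ('g, 'x, 'u) tambara \<Rightarrow> bool" where
  "tambara_functor G T \<longleftrightarrow>
     mackey G (val T) (res T) (trn T) \<and>
     semi_mackey G (val T) (res T) (nrm T) \<and>
     (\<forall>A X Y p f Z Q l r q. exponential_diagram G A X Y p f Z Q l r q \<longrightarrow>
        (\<forall>a\<in>val T A. nrm T X Y f (trn T A X p a) = trn T Q Y q (nrm T Z Q r (res T Z A l a))))"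

definition tam_ring ::
    "('g, 'b) monoid_scheme \<Rightarrow> ('g, 'x, 'u) tambara \<Rightarrow> ('g, 'x) gset \<Rightarrow> 'u ring" where
  "tam_ring G T X =
     \<lparr>carrier = val T X,
      mult = mult (mackey_monoid G (val T) (res T) (nrm T) X),
      one = one (mackey_monoid G (val T) (res T) (nrm T) X),
      zero = one (mackey_monoid G (val T) (res T) (trn T) X),
      add = mult (mackey_monoid G (val T) (res T) (trn T) X)\<rparr>"

text \<open>
  A morphism is a family indexed by the finite \<open>G\<close>-sets. It is extensional, both as a family and
  in each component, so that equality of morphisms is equality in the logic.
\<close>

type_synonym ('g, 'x, 'u) family = "('g, 'x) gset \<Rightarrow> 'u \<Rightarrow> 'u"

definition tam_hom ::
    "('g, 'b) monoid_scheme \<Rightarrow> ('g, 'x, 'u) tambara \<Rightarrow> ('g, 'x, 'v) tambara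
      \<Rightarrow> (('g, 'x) gset \<Rightarrow> 'u \<Rightarrow> 'v) set" where
  "tam_hom G T S =
     {\<phi> \<in> extensional (Collect (fin_gset G)).
        (\<forall>X. fin_gset G X \<longrightarrow>
           \<phi> X \<in> ring_hom (tam_ring G T X) (tam_ring G S X) \<and> \<phi> X \<in> extensional (val T X)) \<and>
        (\<forall>X Y f. fin_gset G X \<longrightarrow> fin_gset G Y \<longrightarrow> f \<in> gmap G X Y \<longrightarrow>
           (\<forall>b\<in>val T Y. \<phi> X (res T X Y f b) = res S X Y f (\<phi> Y b)) \<and>
           (\<forall>a\<in>val T X. \<phi> Y (trn T X Y f a) = trn S X Y f (\<phi> X a)) \<and>
           (\<forall>a\<in>val T X. \<phi> Y (nrm T X Y f a) = nrm S X Y f (\<phi> X a)))}"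

definition MRC :: "('g, 'b) monoid_scheme \<Rightarrow> ('g, 'x, 'u) tambara \<Rightarrow> bool" where
  "MRC G T \<longleftrightarrow>
     (\<forall>X Y f. transitive_gset G X \<longrightarrow> transitive_gset G Y \<longrightarrow> f \<in> gmap G X Y \<longrightarrow>
        inj_on (res T X Y f) (val T Y))"

text \<open>
  The ideal \<open>\<I>\<^sup>T\<^bsub>(0)\<^esub>\<close>. Running over all copies \<open>E\<close> of \<open>G/e\<close> instead of one
  does not change the intersection.
\<close>

definition ideal_zero ::
    "('g, 'b) monoid_scheme \<Rightarrow> ('g, 'x, 'u) tambara \<Rightarrow> ('g, 'x) gset \<Rightarrow> 'u set" where
  "ideal_zero G T X =
     {a \<in> val T X. \<forall>E \<gamma>. is_G_mod_e G E \<longrightarrow> \<gamma> \<in> gmap G E X \<longrightarrow>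
        res T E X \<gamma> a = \<zero>\<^bsub>tam_ring G T E\<^esub>}"

text \<open>
  The map of quotients induced by \<open>h\<close>, where \<open>J\<close> is an ideal of the target. The union of the
  cosets of all \<open>h a\<close>, for \<open>a\<close> in the coset \<open>C\<close>, is itself a coset precisely when the
  induced map is well-defined at \<open>C\<close>.
\<close>

definition induced :: "('v, 'c) ring_scheme \<Rightarrow> 'v set \<Rightarrow> ('u \<Rightarrow> 'v) \<Rightarrow> 'u set \<Rightarrow> 'v set" where
  "induced S J h C = (\<Union>a\<in>C. J +>\<^bsub>S\<^esub> h a)"

definition tam_quotient ::
    "('g, 'b) monoid_scheme \<Rightarrow> ('g, 'x, 'u) tambara \<Rightarrow> (('g, 'x) gset \<Rightarrow> 'u set)
      \<Rightarrow> ('g, 'x, 'u set) tambara" where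
  "tam_quotient G T I =
     \<lparr>val = (\<lambda>X. carrier (tam_ring G T X Quot I X)),
      res = (\<lambda>X Y f. induced (tam_ring G T X) (I X) (res T X Y f)),
      trn = (\<lambda>X Y f. induced (tam_ring G T Y) (I Y) (trn T X Y f)),
      nrm = (\<lambda>X Y f. induced (tam_ring G T Y) (I Y) (nrm T X Y f))\<rparr>"

text \<open>
  The elements of \<open>T/I\<close> are cosets, of type \<open>'u set\<close>. In order to have \<open>T\<close> and \<open>T\<^bsub>MRC\<^esub>\<close>
  in the same category, the structure of \<open>T/I\<close> is transported along the bijection from
  cosets to a system of representatives.
\<close>

definition coset_rep :: "'u set \<Rightarrow> 'u" where
  "coset_rep C = (SOME a. a \<in> C)"

definition transport :: "('v \<Rightarrow> 'u) \<Rightarrow> ('g, 'x, 'v) tambara \<Rightarrow> ('g, 'x, 'u) tambara" where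
  "transport e T =
     \<lparr>val = (\<lambda>X. e ` val T X),
      res = (\<lambda>X Y f b. e (res T X Y f (inv_into (val T Y) e b))),
      trn = (\<lambda>X Y f a. e (trn T X Y f (inv_into (val T X) e a))),
      nrm = (\<lambda>X Y f a. e (nrm T X Y f (inv_into (val T X) e a)))\<rparr>"

definition tam_MRC ::
    "('g, 'b) monoid_scheme \<Rightarrow> ('g, 'x, 'u) tambara \<Rightarrow> ('g, 'x, 'u) tambara" where
  "tam_MRC G T = transport coset_rep (tam_quotient G T (ideal_zero G T))"

definition tam_MRC_map ::
    "('g, 'b) monoid_scheme \<Rightarrow> ('g, 'x, 'u) tambara \<Rightarrow> ('g, 'x, 'u) tambara
      \<Rightarrow> ('g, 'x, 'u) family \<Rightarrow> ('g, 'x, 'u) family" where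
  "tam_MRC_map G T S \<phi> =
     (\<lambda>X\<in>Collect (fin_gset G). \<lambda>a\<in>val (tam_MRC G T) X.
        coset_rep (induced (tam_ring G S X) (ideal_zero G S X) (\<phi> X)
          (inv_into (val (tam_quotient G T (ideal_zero G T)) X) coset_rep a)))"

section \<open>Categories, functors, adjunctions\<close>

record ('o, 'm) category =
  Obj :: "'o set"
  Hom :: "'o \<Rightarrow> 'o \<Rightarrow> 'm set"
  Id :: "'o \<Rightarrow> 'm"
  Comp :: "'o \<Rightarrow> 'o \<Rightarrow> 'o \<Rightarrow> 'm \<Rightarrow> 'm \<Rightarrow> 'm"
    \<comment> \<open>\<open>Comp C A B D h f\<close> is \<open>h \<circ> f\<close> for \<open>f : A \<rightarrow> B\<close> and \<open>h : B \<rightarrow> D\<close>\<close>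

definition is_category :: "('o, 'm) category \<Rightarrow> bool" where
  "is_category C \<longleftrightarrow>
     (\<forall>A\<in>Obj C. Id C A \<in> Hom C A A) \<and>
     (\<forall>A\<in>Obj C. \<forall>B\<in>Obj C. \<forall>D\<in>Obj C. \<forall>f\<in>Hom C A B. \<forall>h\<in>Hom C B D.
        Comp C A B D h f \<in> Hom C A D) \<and>
     (\<forall>A\<in>Obj C. \<forall>B\<in>Obj C. \<forall>f\<in>Hom C A B.
        Comp C A A B f (Id C A) = f \<and> Comp C A B B (Id C B) f = f) \<and>
     (\<forall>A\<in>Obj C. \<forall>B\<in>Obj C. \<forall>D\<in>Obj C. \<forall>E\<in>Obj C.
        \<forall>f\<in>Hom C A B. \<forall>h\<in>Hom C B D. \<forall>k\<in>Hom C D E.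
        Comp C A B E (Comp C B D E k h) f = Comp C A D E k (Comp C A B D h f))"

definition full_subcategory :: "('o, 'm) category \<Rightarrow> ('o \<Rightarrow> bool) \<Rightarrow> ('o, 'm) category" where
  "full_subcategory C P = C\<lparr>Obj := {A \<in> Obj C. P A}\<rparr>"

record ('o, 'm, 'p, 'n) cat_functor =
  on_obj :: "'o \<Rightarrow> 'p"
  on_hom :: "'o \<Rightarrow> 'o \<Rightarrow> 'm \<Rightarrow> 'n"

definition is_functor ::
    "('o, 'm) category \<Rightarrow> ('p, 'n) category \<Rightarrow> ('o, 'm, 'p, 'n) cat_functor \<Rightarrow> bool" where
  "is_functor C D F \<longleftrightarrow>
     is_category C \<and> is_category D \<and>
     (\<forall>A\<in>Obj C. on_obj F A \<in> Obj D) \<and>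
     (\<forall>A\<in>Obj C. \<forall>B\<in>Obj C. \<forall>f\<in>Hom C A B. on_hom F A B f \<in> Hom D (on_obj F A) (on_obj F B)) \<and>
     (\<forall>A\<in>Obj C. on_hom F A A (Id C A) = Id D (on_obj F A)) \<and>
     (\<forall>A\<in>Obj C. \<forall>B\<in>Obj C. \<forall>E\<in>Obj C. \<forall>f\<in>Hom C A B. \<forall>h\<in>Hom C B E.
        on_hom F A E (Comp C A B E h f) =
        Comp D (on_obj F A) (on_obj F B) (on_obj F E) (on_hom F B E h) (on_hom F A B f))"

definition inclusion_functor :: "('o, 'm, 'o, 'm) cat_functor" where
  "inclusion_functor = \<lparr>on_obj = (\<lambda>A. A), on_hom = (\<lambda>A B f. f)\<rparr>"

text \<open>\<open>F : C \<rightarrow> D\<close> is left adjoint to \<open>U : D \<rightarrow> C\<close>.\<close>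

definition is_left_adjoint ::
    "('o, 'm) category \<Rightarrow> ('p, 'n) category
      \<Rightarrow> ('o, 'm, 'p, 'n) cat_functor \<Rightarrow> ('p, 'n, 'o, 'm) cat_functor \<Rightarrow> bool" where
  "is_left_adjoint C D F U \<longleftrightarrow>
     is_functor C D F \<and> is_functor D C U \<and>
     (\<exists>\<Phi>.
       (\<forall>A\<in>Obj C. \<forall>B\<in>Obj D. bij_betw (\<Phi> A B) (Hom D (on_obj F A) B) (Hom C A (on_obj U B))) \<and>
       (\<forall>A\<in>Obj C. \<forall>A'\<in>Obj C. \<forall>B\<in>Obj D. \<forall>B'\<in>Obj D.
          \<forall>f\<in>Hom C A' A. \<forall>k\<in>Hom D B B'. \<forall>h\<in>Hom D (on_obj F A) B.
          \<Phi> A' B'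
            (Comp D (on_obj F A') B B' k
              (Comp D (on_obj F A') (on_obj F A) B h (on_hom F A' A f))) =
          Comp C A' (on_obj U B) (on_obj U B') (on_hom U B B' k)
            (Comp C A' A (on_obj U B) (\<Phi> A B h) f)))"

section \<open>The categories of Tambara functors\<close>

type_synonym ('g, 'x, 'u) tam_category = "(('g, 'x, 'u) tambara, ('g, 'x, 'u) family) category"

definition Tam :: "('g, 'b) monoid_scheme \<Rightarrow> ('g, 'x, 'u) tam_category" where
  "Tam G =
     \<lparr>Obj = Collect (tambara_functor G),
      Hom = tam_hom G,
      Id = (\<lambda>T. \<lambda>X\<in>Collect (fin_gset G). \<lambda>a\<in>val T X. a),
      Comp = (\<lambda>T S R \<psi> \<phi>. \<lambda>X\<in>Collect (fin_gset G). compose (val T X) (\<psi> X) (\<phi> X))\<rparr>"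

definition TamMRC :: "('g, 'b) monoid_scheme \<Rightarrow> ('g, 'x, 'u) tam_category" where
  "TamMRC G = full_subcategory (Tam G) (MRC G)"

definition MRC_functor ::
    "('g, 'b) monoid_scheme
      \<Rightarrow> (('g, 'x, 'u) tambara, ('g, 'x, 'u) family, ('g, 'x, 'u) tambara, ('g, 'x, 'u) family) cat_functor"
  where
  "MRC_functor G = \<lparr>on_obj = tam_MRC G, on_hom = tam_MRC_map G\<rparr>"

end

theory Submission
  imports Defs
begin

text \<open>
  Call two elements of \<open>T X\<close> equivalent if their restrictions along every map \<open>G/e \<rightarrow> X\<close> agree;
  the classes are the cosets of \<open>\<I>\<^bsub>(0)\<^esub>\<close>. By base change along \<open>G/e \<rightarrow> Y\<close>, compatibility of
  \<open>f\<^sub>+\<close> and \<open>f\<^sub>\<bullet>\<close> with this equivalence reduces to \<open>X\<close> free, where \<open>X\<close> is a disjoint union of copies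
  of \<open>G/e\<close> and equivalent elements are equal. All axioms then pass to the quotient, and the ring
  operations need no separate treatment, being defined by the structure maps. If \<open>S\<close> satisfies
  (MRC), equivalent elements of \<open>S X\<close> are equal, so every morphism \<open>T \<rightarrow> S\<close> is constant on
  classes; this is the universal property behind the adjunction.
\<close>

section \<open>Constructions with finite \<open>G\<close>-sets\<close>

text \<open>Equivalence is phrased through restriction alone (\<open>free_eq\<close>). Transfers and
  norms share their restrictions, so one argument for semi-Mackey functors covers both, and for
  norms the shifted ideal condition becomes plain compatibility with a relation. The group structure
  of addition serves to identify the classes with the cosets of \<open>ideal_zero\<close>. Types are
  the obstacle. Points of \<open>G\<close>-sets must lie in \<open>'x\<close>, while pull-backs,
  coproducts and \<open>G/e\<close> first arise on other types; being finite, they can be copied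
  into the infinite type \<open>'x\<close>. Likewise the quotient has values of type
  \<open>'u set\<close>, while an object of the category of \<open>T\<close> has values of type
  \<open>'u\<close>, so its structure is moved to chosen representatives. Both passages, to cosets
  and then to representatives, are instances of one principle: a surjective natural family out of a
  Tambara functor makes its target a Tambara functor, provided that equality of images over a
  coproduct can be tested on the two summands.\<close>

lemma fin_gset_finite: "fin_gset G X \<Longrightarrow> finite (pts X)"
  by (simp add: fin_gset_def)

lemma act_closed: "\<lbrakk>fin_gset G X; g \<in> carrier G; x \<in> pts X\<rbrakk> \<Longrightarrow> act X g x \<in> pts X"
  using group_action.element_image by (fastforce simp: fin_gset_def)

lemma act_one: "\<lbrakk>fin_gset G X; x \<in> pts X\<rbrakk> \<Longrightarrow> act X \<one>\<^bsub>G\<^esub> x = x"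
  by (metis fin_gset_def group_action.id_eq_one restrict_apply')

lemma act_mult:
  "\<lbrakk>fin_gset G X; g \<in> carrier G; h \<in> carrier G; x \<in> pts X\<rbrakk>
    \<Longrightarrow> act X (g \<otimes>\<^bsub>G\<^esub> h) x = act X g (act X h x)"
  using group_action.composition_rule by (fastforce simp: fin_gset_def)

lemma gmap_closed: "\<lbrakk>f \<in> gmap G X Y; x \<in> pts X\<rbrakk> \<Longrightarrow> f x \<in> pts Y"
  by (auto simp: gmap_def)

lemma gmap_act:
  "\<lbrakk>f \<in> gmap G X Y; g \<in> carrier G; x \<in> pts X\<rbrakk> \<Longrightarrow> f (act X g x) = act Y g (f x)"
  by (auto simp: gmap_def)

lemma gmap_extensional: "f \<in> gmap G X Y \<Longrightarrow> f \<in> extensional (pts X)"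
  by (auto simp: gmap_def PiE_def)

lemma gmap_restrictI:
  assumes "fin_gset G X" "\<And>x. x \<in> pts X \<Longrightarrow> f x \<in> pts Y"
    "\<And>g x. \<lbrakk>g \<in> carrier G; x \<in> pts X\<rbrakk> \<Longrightarrow> f (act X g x) = act Y g (f x)"
  shows "(\<lambda>x\<in>pts X. f x) \<in> gmap G X Y"
  using assms by (auto simp: gmap_def act_closed)

lemma gmap_eqI:
  assumes "f \<in> gmap G X Y" "f' \<in> gmap G X Y'" "\<And>x. x \<in> pts X \<Longrightarrow> f x = f' x"
  shows "f = f'"
  using assms gmap_extensional extensionalityI by metis

lemma gmap_compose:
  assumes "fin_gset G X" "f \<in> gmap G X Y" "h \<in> gmap G Y Z"
  shows "compose (pts X) h f \<in> gmap G X Z"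
  unfolding compose_def using assms
  by (intro gmap_restrictI) (auto simp: gmap_closed gmap_act)

lemma gid_gmap: "fin_gset G X \<Longrightarrow> gid X \<in> gmap G X X"
  unfolding gid_def by (intro gmap_restrictI) auto

text \<open>The action is cut off outside \<open>S\<close> because \<open>group_action\<close> maps
  into \<open>BijGroup S\<close>, whose elements are extensional on \<open>S\<close>.\<close>

definition gsub :: "('g, 'x) gset \<Rightarrow> 'x set \<Rightarrow> ('g, 'x) gset" where
  "gsub X S = \<lparr>pts = S, act = (\<lambda>g. \<lambda>x\<in>S. act X g x)\<rparr>"

lemma gsub_simps [simp]: "pts (gsub X S) = S" "x \<in> S \<Longrightarrow> act (gsub X S) g x = act X g x"
  by (auto simp: gsub_def)

definition gorbit :: "('g, 'b) monoid_scheme \<Rightarrow> ('g, 'x) gset \<Rightarrow> 'x \<Rightarrow> 'x set" where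
  "gorbit G X x = (\<lambda>g. act X g x) ` carrier G"

lemma transitive_gsetI:
  assumes "fin_gset G X" "pts X \<noteq> {}"
    "\<And>x y. \<lbrakk>x \<in> pts X; y \<in> pts X\<rbrakk> \<Longrightarrow> \<exists>g\<in>carrier G. act X g x = y"
  shows "transitive_gset G X"
  using assms
  by (auto simp: transitive_gset_def transitive_action_def transitive_action_axioms_def fin_gset_def)

lemma transitive_gsetD:
  assumes "transitive_gset G X" "x \<in> pts X" "y \<in> pts X"
  obtains g where "g \<in> carrier G" "act X g x = y"
  using assms transitive_action.unique_orbit unfolding transitive_gset_def by metis

text \<open>The choices over which the description in \<open>mackey_monoid\<close> ranges, apart
  from the element of \<open>M W\<close>.\<close>

definition is_fold ::
    "('a, 'b) monoid_scheme \<Rightarrow> ('a, 'x) gset \<Rightarrow> ('a, 'x) gset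
      \<Rightarrow> ('x \<Rightarrow> 'x) \<Rightarrow> ('x \<Rightarrow> 'x) \<Rightarrow> ('x \<Rightarrow> 'x) \<Rightarrow> bool" where
  "is_fold G X W i j d \<longleftrightarrow> gcoproduct G X X W i j \<and> d \<in> gmap G W X \<and>
     (\<forall>x\<in>pts X. d (i x) = x \<and> d (j x) = x)"

context group
begin

text \<open>The action of \<open>inv g\<close> inverts that of \<open>g\<close>, which gives
  bijectivity on \<open>P\<close>; restricting to \<open>P\<close> makes the action extensional, as
  \<open>Bij P\<close> demands.\<close>

lemma fin_gsetI:
  assumes "finite P"
    and closed: "\<And>g x. \<lbrakk>g \<in> carrier G; x \<in> P\<rbrakk> \<Longrightarrow> a g x \<in> P"
    and one: "\<And>x. x \<in> P \<Longrightarrow> a \<one> x = x"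
    and mult: "\<And>g h x. \<lbrakk>g \<in> carrier G; h \<in> carrier G; x \<in> P\<rbrakk> \<Longrightarrow> a (g \<otimes> h) x = a g (a h x)"
  shows "fin_gset G \<lparr>pts = P, act = (\<lambda>g. \<lambda>x\<in>P. a g x)\<rparr>"
proof -
  have Bij: "(\<lambda>x\<in>P. a g x) \<in> Bij P" if g: "g \<in> carrier G" for g
  proof -
    have "bij_betw (\<lambda>x\<in>P. a g x) P P"
      by (rule bij_betwI[where g = "\<lambda>x\<in>P. a (inv g) x"])
        (auto simp: g closed mult[symmetric] one)
    then show ?thesis
      by (simp add: Bij_def)
  qed
  have "(\<lambda>g. \<lambda>x\<in>P. a g x) \<in> hom G (BijGroup P)"
  proof (rule homI)
    show "(\<lambda>x\<in>P. a (g \<otimes> h) x) = (\<lambda>x\<in>P. a g x) \<otimes>\<^bsub>BijGroup P\<^esub> (\<lambda>x\<in>P. a h x)"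
      if "g \<in> carrier G" "h \<in> carrier G" for g h
      using that Bij by (auto simp: BijGroup_def compose_def closed mult)
  qed (use Bij in \<open>auto simp: BijGroup_def\<close>)
  then show ?thesis
    using \<open>finite P\<close> group_BijGroup is_group
    by (auto simp: fin_gset_def group_action_def group_hom_def group_hom_axioms_def)
qed

text \<open>A finite set injects into any infinite type. This brings sets built on pairs, or on the
  elements of the group, back to the point type \<open>'x\<close>.\<close>

lemma gset_copy:
  fixes Y :: "('a, 'y) gset"
  assumes Y: "fin_gset G Y"
  obtains X :: "('a, 'x::infinite) gset" and c where "fin_gset G X" "c \<in> giso G X Y"
proof -
  obtain e :: "'y \<Rightarrow> 'x" where e: "inj_on e (pts Y)"
    using arb_inj_on_finite_infinite fin_gset_finite[OF Y] by blast
  let ?P = "e ` pts Y"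
  let ?c = "inv_into (pts Y) e"
  define X where "X = \<lparr>pts = ?P, act = (\<lambda>g::'a. \<lambda>x\<in>?P. e (act Y g (?c x)))\<rparr>"
  have X: "fin_gset G X"
    unfolding X_def
    by (rule fin_gsetI) (auto simp: fin_gset_finite[OF Y] e act_closed[OF Y] act_one[OF Y] act_mult[OF Y])
  have "(\<lambda>x\<in>pts X. ?c x) \<in> gmap G X Y"
    by (rule gmap_restrictI[OF X]) (auto simp: X_def e act_closed[OF Y])
  moreover have "bij_betw (\<lambda>x\<in>pts X. ?c x) (pts X) (pts Y)"
    using bij_betw_inv_into[OF inj_on_imp_bij_betw[OF e]] by (simp add: X_def bij_betw_restrict_eq)
  ultimately show thesis
    using that[OF X] by (simp only: giso_def mem_Collect_eq)
qed

lemma fin_gset_gsub: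
  assumes X: "fin_gset G X" and S: "S \<subseteq> pts X"
    and inv: "\<And>g x. \<lbrakk>g \<in> carrier G; x \<in> S\<rbrakk> \<Longrightarrow> act X g x \<in> S"
  shows "fin_gset G (gsub X S)"
  unfolding gsub_def
  by (rule fin_gsetI)
    (use S in \<open>auto simp: inv act_one[OF X] act_mult[OF X] finite_subset[OF S] fin_gset_finite[OF X] subset_eq\<close>)

lemma gsub_gmap:
  assumes X: "fin_gset G X" and S: "S \<subseteq> pts X"
    and inv: "\<And>g x. \<lbrakk>g \<in> carrier G; x \<in> S\<rbrakk> \<Longrightarrow> act X g x \<in> S"
  shows "(\<lambda>x\<in>S. x) \<in> gmap G (gsub X S) X"
  using gmap_restrictI[OF fin_gset_gsub[OF assms], of "\<lambda>x. x" X] S by auto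

lemma gorbit_subset: "\<lbrakk>fin_gset G X; x \<in> pts X\<rbrakk> \<Longrightarrow> gorbit G X x \<subseteq> pts X"
  by (auto simp: gorbit_def act_closed)

lemma gorbit_self: "\<lbrakk>fin_gset G X; x \<in> pts X\<rbrakk> \<Longrightarrow> x \<in> gorbit G X x"
  unfolding gorbit_def by (rule image_eqI[where x = \<one>]) (simp_all add: act_one)

lemma act_inv_cancel:
  "\<lbrakk>fin_gset G X; g \<in> carrier G; x \<in> pts X\<rbrakk> \<Longrightarrow> act X (inv g) (act X g x) = x"
  by (simp add: act_mult[symmetric] act_one)

text \<open>As an equivalence it shows at once that an orbit and its complement are both stable
  under \<open>G\<close>, which is what splitting off an orbit requires.\<close>

lemma act_gorbit_iff:
  assumes X: "fin_gset G X" and x: "x \<in> pts X" and g: "g \<in> carrier G" and y: "y \<in> pts X"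
  shows "act X g y \<in> gorbit G X x \<longleftrightarrow> y \<in> gorbit G X x"
proof
  assume "y \<in> gorbit G X x"
  then obtain h where "h \<in> carrier G" "y = act X h x"
    by (auto simp: gorbit_def)
  then show "act X g y \<in> gorbit G X x"
    using x g unfolding gorbit_def by (intro image_eqI[where x = "g \<otimes> h"]) (auto simp: act_mult[OF X])
next
  assume "act X g y \<in> gorbit G X x"
  then obtain h where h: "h \<in> carrier G" "act X g y = act X h x"
    by (auto simp: gorbit_def)
  have "y = act X (inv g \<otimes> h) x"
    using h(1) g x by (simp add: act_mult[OF X] act_inv_cancel[OF X g y] flip: h(2))
  then show "y \<in> gorbit G X x"
    using g h unfolding gorbit_def by (intro image_eqI[where x = "inv g \<otimes> h"]) auto
qed

lemma transitive_gorbit: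
  assumes X: "fin_gset G X" and x: "x \<in> pts X"
  shows "transitive_gset G (gsub X (gorbit G X x))"
proof (rule transitive_gsetI)
  show "fin_gset G (gsub X (gorbit G X x))"
    using gorbit_subset[OF assms] act_gorbit_iff[OF assms] by (intro fin_gset_gsub[OF X]) auto
  show "pts (gsub X (gorbit G X x)) \<noteq> {}"
    using gorbit_self[OF assms] by auto
  fix y z
  assume "y \<in> pts (gsub X (gorbit G X x))" "z \<in> pts (gsub X (gorbit G X x))"
  then obtain g h where gh: "g \<in> carrier G" "h \<in> carrier G" "y = act X g x" "z = act X h x"
    by (auto simp: gorbit_def)
  then have "act X (h \<otimes> inv g) y = z"
    using x by (simp add: act_mult[OF X] act_closed[OF X] act_inv_cancel[OF X])
  with gh \<open>y \<in> _\<close> show "\<exists>k\<in>carrier G. act (gsub X (gorbit G X x)) k y = z"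
    by (intro bexI[of _ "h \<otimes> inv g"]) auto
qed

lemma fin_gset_gempty: "fin_gset G gempty"
  using fin_gsetI[of "{}" "\<lambda>_ x. x"] by (simp add: gempty_def restrict_def)

lemma gempty_gmap: "(\<lambda>_. undefined) \<in> gmap G gempty X"
  by (auto simp: gmap_def gempty_def)

lemma gpullback_exists:
  fixes X Y' Y :: "('a, 'x::infinite) gset"
  assumes X: "fin_gset G X" and Y': "fin_gset G Y'" and Y: "fin_gset G Y"
    and f: "f \<in> gmap G X Y" and h: "h \<in> gmap G Y' Y"
  obtains X' f' k where "gpullback G X' X Y' Y f' f k h"
proof -
  let ?P = "{(x, y). x \<in> pts X \<and> y \<in> pts Y' \<and> f x = h y}"
  define Q where "Q = \<lparr>pts = ?P, act = (\<lambda>g::'a. \<lambda>q\<in>?P. (act X g (fst q), act Y' g (snd q)))\<rparr>"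
  have "?P \<subseteq> pts X \<times> pts Y'"
    by auto
  then have "finite ?P"
    using fin_gset_finite[OF X] fin_gset_finite[OF Y'] finite_subset by blast
  then have Q: "fin_gset G Q"
    unfolding Q_def
    by (rule fin_gsetI)
      (auto simp: act_closed[OF X] act_closed[OF Y'] act_one[OF X] act_one[OF Y']
        act_mult[OF X] act_mult[OF Y'] gmap_act[OF f] gmap_act[OF h])
  obtain X' :: "('a, 'x) gset" and c where X': "fin_gset G X'" and c: "c \<in> giso G X' Q"
    using gset_copy[OF Q] by metis
  have cm: "c \<in> gmap G X' Q" and cb: "bij_betw c (pts X') ?P"
    using c by (auto simp: giso_def Q_def)
  have cP: "c x \<in> ?P" if "x \<in> pts X'" for x
    using gmap_closed[OF cm that] by (simp add: Q_def)
  have k: "(\<lambda>x\<in>pts X'. fst (c x)) \<in> gmap G X' X"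
    using cP by (intro gmap_restrictI[OF X']) (force simp: gmap_act[OF cm] Q_def)+
  have f': "(\<lambda>x\<in>pts X'. snd (c x)) \<in> gmap G X' Y'"
    using cP by (intro gmap_restrictI[OF X']) (force simp: gmap_act[OF cm] Q_def)+
  have "gpullback G X' X Y' Y (\<lambda>x\<in>pts X'. snd (c x)) f (\<lambda>x\<in>pts X'. fst (c x)) h"
    unfolding gpullback_def using assms X' k f' cb by (simp cong: bij_betw_cong)
  then show thesis
    by (rule that)
qed

text \<open>The two copies of \<open>X\<close> are tagged by a boolean on which \<open>G\<close>
  acts trivially; dropping the tag is the folding map. The result is then copied into
  \<open>'x\<close>.\<close>

lemma fold_exists:
  fixes X :: "('a, 'x::infinite) gset"
  assumes X: "fin_gset G X"
  obtains W i j d where "is_fold G X W i j d"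
proof -
  let ?P = "pts X \<times> (UNIV :: bool set)"
  define Q where "Q = \<lparr>pts = ?P, act = (\<lambda>g::'a. \<lambda>q\<in>?P. (act X g (fst q), snd q))\<rparr>"
  have Q: "fin_gset G Q"
    unfolding Q_def
    by (rule fin_gsetI) (auto simp: fin_gset_finite[OF X] act_closed[OF X] act_one[OF X] act_mult[OF X])
  obtain W :: "('a, 'x) gset" and c where W: "fin_gset G W" and c: "c \<in> giso G W Q"
    using gset_copy[OF Q] by metis
  have cm: "c \<in> gmap G W Q" and cb: "bij_betw c (pts W) ?P"
    using c by (auto simp: giso_def Q_def)
  let ?e = "inv_into (pts W) c"
  have db: "bij_betw ?e ?P (pts W)"
    using cb by (rule bij_betw_inv_into)
  have cd: "c (?e q) = q" "?e q \<in> pts W" if "q \<in> ?P" for q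
    using that cb by (auto simp: bij_betw_inv_into_right inv_into_into bij_betw_def)
  \<comment> \<open>The inverse of an equivariant bijection is equivariant: compare images under
    \<open>c\<close>.\<close>
  have dact: "?e (act X g x, b) = act W g (?e (x, b))" if "g \<in> carrier G" "x \<in> pts X" for g x b
  proof -
    have "c (act W g (?e (x, b))) = (act X g x, b)"
      using that by (subst gmap_act[OF cm]) (auto simp: cd Q_def)
    moreover have "act W g (?e (x, b)) \<in> pts W"
      using that by (intro act_closed[OF W]) (auto simp: cd)
    ultimately show ?thesis
      using cb by (metis bij_betw_inv_into_left)
  qed
  have i: "(\<lambda>x\<in>pts X. ?e (x, b)) \<in> gmap G X W" for b
    by (intro gmap_restrictI[OF X]) (auto simp: cd dact)
  have fold: "(\<lambda>w\<in>pts W. fst (c w)) \<in> gmap G W X"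
    using gmap_closed[OF cm] by (intro gmap_restrictI[OF W]) (force simp: gmap_act[OF cm] Q_def)+
  have inj: "inj_on ?e ?P" and im: "?e ` ?P = pts W"
    using db by (auto simp: bij_betw_def)
  have "gcoproduct G X X W (\<lambda>x\<in>pts X. ?e (x, True)) (\<lambda>x\<in>pts X. ?e (x, False))"
    unfolding gcoproduct_def
  proof (intro conjI X W i)
    show "inj_on (\<lambda>x\<in>pts X. ?e (x, True)) (pts X)" "inj_on (\<lambda>x\<in>pts X. ?e (x, False)) (pts X)"
      using inj by (auto simp: inj_on_def)
    show "(\<lambda>x\<in>pts X. ?e (x, True)) ` pts X \<inter> (\<lambda>x\<in>pts X. ?e (x, False)) ` pts X = {}"
      using inj by (auto simp: inj_on_def)
    have "?e ` ?P = ?e ` ((\<lambda>x. (x, True)) ` pts X \<union> (\<lambda>x. (x, False)) ` pts X)"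
      by (rule arg_cong[where f = "image ?e"]) auto
    then show "(\<lambda>x\<in>pts X. ?e (x, True)) ` pts X \<union> (\<lambda>x\<in>pts X. ?e (x, False)) ` pts X = pts W"
      unfolding im by (simp add: image_Un image_image)
  qed
  then have "is_fold G X W (\<lambda>x\<in>pts X. ?e (x, True)) (\<lambda>x\<in>pts X. ?e (x, False)) (\<lambda>w\<in>pts W. fst (c w))"
    using fold cd by (auto simp: is_fold_def)
  then show thesis
    by (rule that)
qed

section \<open>Copies of \<open>G/e\<close> and maps from and to them\<close>

lemma fin_gset_regular: "finite (carrier G) \<Longrightarrow> fin_gset G (regular_gset G)"
  unfolding regular_gset_def by (rule fin_gsetI) (auto simp: m_assoc)

lemma is_G_mod_e_exists:
  assumes "finite (carrier G)"
  obtains E :: "('a, 'x::infinite) gset" where "is_G_mod_e G E"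
  using gset_copy[OF fin_gset_regular[OF assms]] unfolding is_G_mod_e_def by blast

text \<open>Identifies \<open>E\<close> with \<open>G\<close> under left translation, so that
  statements about copies of \<open>G/e\<close> become computations in the group.\<close>

lemma is_G_mod_e_coordinate:
  assumes "is_G_mod_e G E"
  obtains c where "bij_betw c (pts E) (carrier G)"
    "\<And>g e. \<lbrakk>g \<in> carrier G; e \<in> pts E\<rbrakk> \<Longrightarrow> c (act E g e) = g \<otimes> c e"
proof -
  obtain c where c: "c \<in> giso G E (regular_gset G)"
    using assms by (auto simp: is_G_mod_e_def)
  then have "c e \<in> carrier G" if "e \<in> pts E" for e
    using that by (auto simp: giso_def regular_gset_def dest: gmap_closed)
  then show thesis
    using c that[of c] by (auto simp: giso_def regular_gset_def gmap_act)
qed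

lemma is_G_mod_e_transitive:
  assumes E: "is_G_mod_e G E"
  shows "transitive_gset G E"
proof -
  have E': "fin_gset G E"
    using E by (simp add: is_G_mod_e_def)
  obtain c where c: "bij_betw c (pts E) (carrier G)"
    and ca: "\<And>g e. \<lbrakk>g \<in> carrier G; e \<in> pts E\<rbrakk> \<Longrightarrow> c (act E g e) = g \<otimes> c e"
    using is_G_mod_e_coordinate[OF E] by metis
  have cc: "c e \<in> carrier G" if "e \<in> pts E" for e
    using that c by (auto simp: bij_betw_def)
  show ?thesis
  proof (rule transitive_gsetI[OF E'])
    show "pts E \<noteq> {}"
      using c one_closed by (auto simp: bij_betw_def)
    show "\<exists>g\<in>carrier G. act E g x = y" if "x \<in> pts E" "y \<in> pts E" for x y
    proof (rule bexI)
      show "c y \<otimes> inv c x \<in> carrier G"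
        using that cc by auto
      then have "c (act E (c y \<otimes> inv c x) x) = c y" "act E (c y \<otimes> inv c x) x \<in> pts E"
        using that cc by (auto simp: ca m_assoc act_closed[OF E'])
      then show "act E (c y \<otimes> inv c x) x = y"
        using that c by (metis bij_betw_inv_into_left)
    qed
  qed
qed

text \<open>\<open>G/e\<close> is free on any of its points: \<open>y\<close> arises from
  \<open>e\<close> by acting with \<open>c y \<otimes> inv c e\<close>, which forces the formula for
  the map.\<close>

lemma is_G_mod_e_lift:
  assumes E: "is_G_mod_e G E" and X: "fin_gset G X" and e: "e \<in> pts E" and x: "x \<in> pts X"
  obtains f where "f \<in> gmap G E X" "f e = x"
proof -
  have E': "fin_gset G E"
    using E by (simp add: is_G_mod_e_def)
  obtain c where c: "bij_betw c (pts E) (carrier G)"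
    and ca: "\<And>g e. \<lbrakk>g \<in> carrier G; e \<in> pts E\<rbrakk> \<Longrightarrow> c (act E g e) = g \<otimes> c e"
    using is_G_mod_e_coordinate[OF E] by metis
  have cc: "c e \<in> carrier G" if "e \<in> pts E" for e
    using that c by (auto simp: bij_betw_def)
  let ?f = "\<lambda>y\<in>pts E. act X (c y \<otimes> inv c e) x"
  have "?f \<in> gmap G E X"
    using e x cc by (intro gmap_restrictI[OF E']) (auto simp: act_closed[OF X] act_mult[OF X] ca)
  moreover have "?f e = x"
    using e x cc by (simp add: act_one[OF X])
  ultimately show thesis
    by (rule that)
qed

text \<open>A point of \<open>X\<close> has trivial stabilizer because its image in \<open>E\<close>
  has, and a transitive set with trivial stabilizers is a copy of \<open>G/e\<close>. The
  isomorphism is \<open>f\<close> followed by the coordinate of \<open>E\<close>.\<close>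

lemma is_G_mod_e_if_gmap:
  assumes E: "is_G_mod_e G E" and X: "transitive_gset G X" and f: "f \<in> gmap G X E"
  shows "is_G_mod_e G X"
proof -
  have E': "fin_gset G E" and X': "fin_gset G X"
    using E X by (auto simp: is_G_mod_e_def transitive_gset_def)
  obtain c where c: "bij_betw c (pts E) (carrier G)"
    and ca: "\<And>g e. \<lbrakk>g \<in> carrier G; e \<in> pts E\<rbrakk> \<Longrightarrow> c (act E g e) = g \<otimes> c e"
    using is_G_mod_e_coordinate[OF E] by metis
  have cc: "c e \<in> carrier G" if "e \<in> pts E" for e
    using that c by (auto simp: bij_betw_def)
  have fc: "f x \<in> pts E" if "x \<in> pts X" for x
    using gmap_closed[OF f that] .
  let ?k = "\<lambda>x\<in>pts X. c (f x)"
  have "?k \<in> gmap G X (regular_gset G)"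
    by (rule gmap_restrictI[OF X']) (auto simp: regular_gset_def cc fc gmap_act[OF f] ca)
  moreover have "bij_betw ?k (pts X) (carrier G)"
    unfolding bij_betw_def
  proof
    show "inj_on ?k (pts X)"
    proof (rule inj_onI)
      fix x y
      assume xy: "x \<in> pts X" "y \<in> pts X" "?k x = ?k y"
      obtain g where g: "g \<in> carrier G" "act X g x = y"
        using transitive_gsetD[OF X xy(1,2)] .
      have "g \<otimes> c (f x) = c (f x)"
        using xy g by (metis ca fc gmap_act[OF f] restrict_apply')
      then have "g = \<one>"
        using g xy cc fc by (simp add: r_cancel_one)
      then show "x = y"
        using g xy act_one[OF X'] by simp
    qed
    obtain x where x: "x \<in> pts X"
      using X by (auto simp: transitive_gset_def)
    show "?k ` pts X = carrier G"
    proof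
      show "carrier G \<subseteq> ?k ` pts X"
      proof
        fix h
        assume h: "h \<in> carrier G"
        let ?g = "h \<otimes> inv c (f x)"
        have "?g \<in> carrier G"
          using h x cc fc by simp
        then have "?k (act X ?g x) = h" "act X ?g x \<in> pts X"
          using h x cc fc by (auto simp: act_closed[OF X'] gmap_act[OF f] ca m_assoc)
        then show "h \<in> ?k ` pts X"
          by (metis image_eqI)
      qed
    qed (auto simp: cc fc)
  qed
  ultimately show ?thesis
    using X' by (auto simp: is_G_mod_e_def giso_def regular_gset_def)
qed

end

section \<open>Coproducts and the monoid on \<open>M X\<close>\<close>

lemma is_foldD:
  assumes "is_fold G X W i j d"
  shows "gcoproduct G X X W i j" "d \<in> gmap G W X"
    "x \<in> pts X \<Longrightarrow> d (i x) = x" "x \<in> pts X \<Longrightarrow> d (j x) = x"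
  using assms by (auto simp: is_fold_def)

lemma gcoproductD:
  assumes "gcoproduct G X Y W i j"
  shows "fin_gset G X" "fin_gset G Y" "fin_gset G W" "i \<in> gmap G X W" "j \<in> gmap G Y W"
  using assms by (auto simp: gcoproduct_def)

lemma gcoproduct_cases:
  assumes "gcoproduct G X Y W i j" "w \<in> pts W"
  obtains x where "x \<in> pts X" "w = i x" | y where "y \<in> pts Y" "w = j y"
  using assms unfolding gcoproduct_def by blast

lemma gcoproduct_copair:
  assumes W: "gcoproduct G X Y W i j" and f: "f \<in> gmap G X V" and h: "h \<in> gmap G Y V"
  obtains u where "u \<in> gmap G W V" "\<And>x. x \<in> pts X \<Longrightarrow> u (i x) = f x" "\<And>y. y \<in> pts Y \<Longrightarrow> u (j y) = h y"
proof -
  let ?u = "\<lambda>w\<in>pts W. if w \<in> i ` pts X then f (inv_into (pts X) i w) else h (inv_into (pts Y) j w)"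
  note D = gcoproductD[OF W]
  have inj: "inj_on i (pts X)" "inj_on j (pts Y)" and dj: "i ` pts X \<inter> j ` pts Y = {}"
    using W by (auto simp: gcoproduct_def)
  have ui: "?u (i x) = f x" if "x \<in> pts X" for x
    using that inj gmap_closed[OF D(4)] by simp
  have uj: "?u (j y) = h y" if "y \<in> pts Y" for y
    using that inj dj gmap_closed[OF D(5)] by auto
  have "?u w \<in> pts V \<and> (\<forall>g\<in>carrier G. ?u (act W g w) = act V g (?u w))" if "w \<in> pts W" for w
    using W that
  proof (cases rule: gcoproduct_cases)
    case (1 x)
    then show ?thesis
      using ui f by (simp del: restrict_apply add: gmap_closed gmap_act act_closed[OF D(1)] flip: gmap_act[OF D(4)])
  next
    case (2 y)
    then show ?thesis
      using uj h by (simp del: restrict_apply add: gmap_closed gmap_act act_closed[OF D(2)] flip: gmap_act[OF D(5)])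
  qed
  then have "?u \<in> gmap G W V"
    by (auto simp del: restrict_apply simp: gmap_def PiE_def)
  then show thesis
    using ui uj by (rule that)
qed

context semi_mackey
begin

lemma pull_in: "\<lbrakk>fin_gset G X; fin_gset G Y; f \<in> gmap G X Y; a \<in> M Y\<rbrakk> \<Longrightarrow> pull X Y f a \<in> M X"
  using pull_closed by blast

lemma push_in: "\<lbrakk>fin_gset G X; fin_gset G Y; f \<in> gmap G X Y; a \<in> M X\<rbrakk> \<Longrightarrow> push X Y f a \<in> M Y"
  using push_closed by blast

lemma coproduct_eqI:
  assumes "gcoproduct G X Y W i j" "a \<in> M W" "b \<in> M W"
    "pull X W i a = pull X W i b" "pull Y W j a = pull Y W j b"
  shows "a = b"
  using coproduct_to_product[OF assms(1)] assms(2-) by (auto simp: bij_betw_def inj_on_def)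

lemma coproduct_glue:
  assumes "gcoproduct G X Y W i j" "a \<in> M X" "b \<in> M Y"
  obtains z where "z \<in> M W" "pull X W i z = a" "pull Y W j z = b"
proof -
  have "(a, b) \<in> (\<lambda>z. (pull X W i z, pull Y W j z)) ` M W"
    using coproduct_to_product[OF assms(1)] assms(2-) by (simp add: bij_betw_def)
  then show thesis
    using that by blast
qed

text \<open>For an isomorphism \<open>u\<close>, the set \<open>W\<close> with both projections
  equal to \<open>u\<close> is a pull-back of the identity of \<open>W'\<close> along itself. Base
  change on that square is the claim.\<close>

lemma push_pull_iso:
  assumes W: "fin_gset G W" and W': "fin_gset G W'" and u: "u \<in> giso G W W'" and a: "a \<in> M W'"
  shows "push W W' u (pull W W' u a) = a"
proof -
  let ?P = "{(x, y). x \<in> pts W' \<and> y \<in> pts W' \<and> gid W' x = gid W' y}"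
  have "bij_betw (\<lambda>x. (x, x)) (pts W') ?P"
    by (auto simp: bij_betw_def inj_on_def gid_def)
  then have "bij_betw (\<lambda>w. (u w, u w)) (pts W) ?P"
    using bij_betw_trans[of u "pts W" "pts W'"] u by (simp add: giso_def comp_def)
  then have "gpullback G W W' W' W' u (gid W') u (gid W')"
    using W W' u gid_gmap[OF W'] by (simp add: gpullback_def giso_def)
  from base_change[OF this a] show ?thesis
    using a W' by (simp add: push_id pull_id)
qed

text \<open>Makes the operation of \<open>mackey_monoid\<close> well defined. Two coproducts are
  isomorphic over \<open>X\<close> by some \<open>u\<close>; elements with the same components
  correspond under restriction along \<open>u\<close>, and \<open>push_pull_iso\<close> cancels that
  restriction against the push along \<open>u\<close>.\<close>

lemma fold_unique:
  assumes F: "is_fold G X W i j d" and F': "is_fold G X W' i' j' d'"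
    and z: "z \<in> M W" and z': "z' \<in> M W'"
    and eq: "pull X W i z = pull X W' i' z'" "pull X W j z = pull X W' j' z'"
  shows "push W X d z = push W' X d' z'"
proof -
  note D = is_foldD[OF F] and D' = is_foldD[OF F']
  note C = gcoproductD[OF D(1)] and C' = gcoproductD[OF D'(1)]
  obtain u where u: "u \<in> gmap G W W'"
    and ui: "\<And>x. x \<in> pts X \<Longrightarrow> u (i x) = i' x" and uj: "\<And>x. x \<in> pts X \<Longrightarrow> u (j x) = j' x"
    using gcoproduct_copair[OF D(1) C'(4,5)] by metis
  obtain v where v: "v \<in> gmap G W' W"
    and vi: "\<And>x. x \<in> pts X \<Longrightarrow> v (i' x) = i x" and vj: "\<And>x. x \<in> pts X \<Longrightarrow> v (j' x) = j x"
    using gcoproduct_copair[OF D'(1) C(4,5)] by metis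
  have "bij_betw u (pts W) (pts W')"
  proof (rule bij_betwI[where g = v])
    show "v (u w) = w" if "w \<in> pts W" for w
      using D(1) that by (cases rule: gcoproduct_cases) (auto simp: ui uj vi vj)
    show "u (v w) = w" if "w \<in> pts W'" for w
      using D'(1) that by (cases rule: gcoproduct_cases) (auto simp: ui uj vi vj)
  qed (use gmap_closed[OF u] gmap_closed[OF v] in auto)
  then have iso: "u \<in> giso G W W'"
    using u by (simp add: giso_def)
  have i: "compose (pts X) u i = i'" and j: "compose (pts X) u j = j'"
    by (rule gmap_eqI[OF gmap_compose[OF C(1) _ u]], rule C C', rule C',
        simp add: compose_eq ui uj)+
  have d: "compose (pts W) d' u = d"
  proof (rule gmap_eqI[OF gmap_compose[OF C(3) u D'(2)] D(2)])
    show "compose (pts W) d' u w = d w" if "w \<in> pts W" for w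
      using D(1) that by (cases rule: gcoproduct_cases) (auto simp: compose_eq ui uj D D' gmap_closed[OF C(4)] gmap_closed[OF C(5)])
  qed
  have "z = pull W W' u z'"
  proof (rule coproduct_eqI[OF D(1) z])
    show "pull W W' u z' \<in> M W"
      using pull_in C C' u z' by blast
    show "pull X W i z = pull X W i (pull W W' u z')"
      using pull_comp[OF C(1) C(3) C'(3) C(4) u z'] by (simp add: i eq)
    show "pull X W j z = pull X W j (pull W W' u z')"
      using pull_comp[OF C(1) C(3) C'(3) C(5) u z'] by (simp add: j eq)
  qed
  then have "push W X d z = push W' X d' (push W W' u (pull W W' u z'))"
    using push_comp[OF C(3) C'(3) C(1) u D'(2) z] by (simp add: d)
  then show ?thesis
    using push_pull_iso[OF C(3) C'(3) iso z'] by simp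
qed

lemma mackey_mult:
  assumes F: "is_fold G X W i j d" and z: "z \<in> M W"
  shows "pull X W i z \<otimes>\<^bsub>mackey_monoid G M pull push X\<^esub> pull X W j z = push W X d z"
proof -
  have "(THE c. \<exists>W' i' j' d' z'. is_fold G X W' i' j' d' \<and>
      z' \<in> M W' \<and> pull X W' i' z' = pull X W i z \<and> pull X W' j' z' = pull X W j z \<and>
      c = push W' X d' z') = push W X d z"
    using F z fold_unique[OF _ F _ z] by (intro the_equality) blast+
  then show ?thesis
    by (simp add: mackey_monoid_def is_fold_def conj_assoc)
qed

lemma empty_unique: "\<lbrakk>fin_gset G X; pts X = {}; a \<in> M X; b \<in> M X\<rbrakk> \<Longrightarrow> a = b"
  using empty_to_point by blast

lemma gempty_element: "(THE z. z \<in> M gempty) \<in> M gempty"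
  by (rule theI', rule empty_to_point[OF fin_gset_gempty]) (simp add: gempty_def)

lemma mackey_one:
  "z \<in> M gempty \<Longrightarrow> \<one>\<^bsub>mackey_monoid G M pull push X\<^esub> = push gempty X (\<lambda>_. undefined) z"
  using empty_unique[OF fin_gset_gempty _ gempty_element] by (simp add: mackey_monoid_def gempty_def)

text \<open>Induction on the number of points: \<open>X\<close> is the coproduct of one orbit and
  its complement, and an element over a coproduct is determined by its restrictions to the
  summands.\<close>

lemma eq_if_pull_orbits_eq:
  assumes "fin_gset G X" "a \<in> M X" "b \<in> M X"
    and "\<And>U f. \<lbrakk>transitive_gset G U; f \<in> gmap G U X\<rbrakk> \<Longrightarrow> pull U X f a = pull U X f b"
  shows "a = b"
  using assms
proof (induction "card (pts X)" arbitrary: X a b rule: less_induct)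
  case less
  note X = less.prems(1)
  show ?case
  proof (cases "pts X = {}")
    case True
    then show ?thesis
      using empty_unique less.prems by blast
  next
    case False
    then obtain x where x: "x \<in> pts X"
      by blast
    let ?S = "gorbit G X x"
    let ?R = "pts X - ?S"
    have S: "?S \<subseteq> pts X" and xS: "x \<in> ?S"
      using gorbit_subset[OF X x] gorbit_self[OF X x] by auto
    have invS: "act X g y \<in> ?S" if "g \<in> carrier G" "y \<in> ?S" for g y
      using that act_gorbit_iff[OF X x] S by blast
    have R: "?R \<subseteq> pts X"
      by auto
    have invR: "act X g y \<in> ?R" if "g \<in> carrier G" "y \<in> ?R" for g y
      using that act_gorbit_iff[OF X x] act_closed[OF X] by blast
    have fS: "fin_gset G (gsub X ?S)" and mS: "(\<lambda>y\<in>?S. y) \<in> gmap G (gsub X ?S) X"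
      using fin_gset_gsub[OF X S] gsub_gmap[OF X S] invS by auto
    have fR: "fin_gset G (gsub X ?R)" and mR: "(\<lambda>y\<in>?R. y) \<in> gmap G (gsub X ?R) X"
      using fin_gset_gsub[OF X R] gsub_gmap[OF X R] invR by auto
    let ?i = "\<lambda>y\<in>?S. y" and ?j = "\<lambda>y\<in>?R. y"
    have coprod: "gcoproduct G (gsub X ?S) (gsub X ?R) X ?i ?j"
      using X fS fR mS mR S by (auto simp: gcoproduct_def inj_on_def)
    show ?thesis
    proof (rule coproduct_eqI[OF coprod less.prems(2,3)])
      show "pull (gsub X ?S) X ?i a = pull (gsub X ?S) X ?i b"
        using less.prems(4) transitive_gorbit[OF X x] mS by blast
      show "pull (gsub X ?R) X ?j a = pull (gsub X ?R) X ?j b"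
      proof (rule less.hyps[OF _ fR])
        show "card (pts (gsub X ?R)) < card (pts X)"
          using x xS fin_gset_finite[OF X] by (auto intro!: psubset_card_mono)
        show "pull (gsub X ?R) X ?j a \<in> M (gsub X ?R)" "pull (gsub X ?R) X ?j b \<in> M (gsub X ?R)"
          using pull_in[OF fR X mR] less.prems by auto
        fix U :: "('g, 'x) gset" and f
        assume U: "transitive_gset G U" and f: "f \<in> gmap G U (gsub X ?R)"
        then have fU: "fin_gset G U"
          by (simp add: transitive_gset_def)
        show "pull U (gsub X ?R) f (pull (gsub X ?R) X ?j a) = pull U (gsub X ?R) f (pull (gsub X ?R) X ?j b)"
          using less.prems(4)[OF U gmap_compose[OF fU f mR]]
          unfolding pull_comp[OF fU fR X f mR less.prems(2)] pull_comp[OF fU fR X f mR less.prems(3)] .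
      qed
    qed
  qed
qed

end

section \<open>Points seen by \<open>G/e\<close>\<close>

definition free_eq ::
    "('g, 'b) monoid_scheme \<Rightarrow> (('g, 'x) gset \<Rightarrow> ('g, 'x) gset \<Rightarrow> ('x \<Rightarrow> 'x) \<Rightarrow> 'u \<Rightarrow> 'u)
      \<Rightarrow> ('g, 'x) gset \<Rightarrow> 'u \<Rightarrow> 'u \<Rightarrow> bool" where
  "free_eq G pull X a b \<longleftrightarrow>
     (\<forall>E \<gamma>. is_G_mod_e G E \<longrightarrow> \<gamma> \<in> gmap G E X \<longrightarrow> pull E X \<gamma> a = pull E X \<gamma> b)"

text \<open>The infinite point type makes room for pull-backs and coproducts; finiteness of the
  group makes \<open>G/e\<close> a finite \<open>G\<close>-set.\<close>

locale semi_mackey_infinite = semi_mackey G M pull push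
  for G :: "('g, 'b) monoid_scheme" (structure)
    and M :: "('g, 'x::infinite) gset \<Rightarrow> 'u set" and pull push +
  assumes finite_group: "finite (carrier G)"
begin

text \<open>\<open>X \<amalg> X\<close> is the pull-back of \<open>Y \<amalg> Y\<close> along
  \<open>f\<close>, so base change moves \<open>pull\<close> past the folding map. Additivity of
  restriction, needed to describe cosets, is the case of transfers.\<close>

lemma pull_hom:
  assumes X: "fin_gset G X" and Y: "fin_gset G Y" and f: "f \<in> gmap G X Y"
  shows "pull X Y f \<in> hom (mackey_monoid G M pull push Y) (mackey_monoid G M pull push X)"
proof (rule homI)
  fix a b
  assume "a \<in> carrier (mackey_monoid G M pull push Y)" "b \<in> carrier (mackey_monoid G M pull push Y)"
  then have ab: "a \<in> M Y" "b \<in> M Y"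
    by (simp_all add: mackey_monoid_def)
  obtain W i j d where F: "is_fold G Y W i j d"
    using fold_exists[OF Y] .
  obtain W' i' j' d' where F': "is_fold G X W' i' j' d'"
    using fold_exists[OF X] .
  note D = is_foldD[OF F] and D' = is_foldD[OF F']
  note C = gcoproductD[OF D(1)] and C' = gcoproductD[OF D'(1)]
  obtain z where z: "z \<in> M W" "pull Y W i z = a" "pull Y W j z = b"
    using coproduct_glue[OF D(1) ab] .
  obtain u where u: "u \<in> gmap G W' W"
    and ui: "\<And>x. x \<in> pts X \<Longrightarrow> u (i' x) = compose (pts X) i f x"
    and uj: "\<And>x. x \<in> pts X \<Longrightarrow> u (j' x) = compose (pts X) j f x"
    using gcoproduct_copair[OF D'(1) gmap_compose[OF X f C(4)] gmap_compose[OF X f C(5)]] by metis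
  have i: "compose (pts X) u i' = compose (pts X) i f" and j: "compose (pts X) u j' = compose (pts X) j f"
    by (auto simp: compose_def ui uj)
  have inj: "inj_on i (pts Y)" "inj_on j (pts Y)" and dj: "i ` pts Y \<inter> j ` pts Y = {}"
    using D(1) by (auto simp: gcoproduct_def)
  have fY: "f x \<in> pts Y" if "x \<in> pts X" for x
    using gmap_closed[OF f that] .
  have "bij_betw (\<lambda>w. (u w, d' w)) (pts W') {(w, x). w \<in> pts W \<and> x \<in> pts X \<and> d w = f x}" (is "bij_betw ?h _ ?P")
    unfolding bij_betw_def
  proof
    show "inj_on ?h (pts W')"
    proof (rule inj_onI)
      fix v w
      assume "v \<in> pts W'" "w \<in> pts W'" "?h v = ?h w"
      \<comment> \<open>Points from different summands stay apart under \<open>u\<close>, as the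
        images of \<open>i\<close> and \<open>j\<close> are disjoint.\<close>
      moreover have "i (f x) \<noteq> j (f y)" "j (f y) \<noteq> i (f x)" if "x \<in> pts X" "y \<in> pts X" for x y
        using that dj fY by force+
      ultimately show "v = w"
        by (auto elim!: gcoproduct_cases[OF D'(1)] simp: D' ui uj compose_eq)
    qed
    show "?h ` pts W' = ?P"
    proof
      show "?h ` pts W' \<subseteq> ?P"
        using fY by (auto elim!: gcoproduct_cases[OF D'(1)]
            simp: D D' ui uj compose_eq gmap_closed[OF C(4)] gmap_closed[OF C(5)])
      show "?P \<subseteq> ?h ` pts W'"
      proof clarify
        fix w x
        assume wx: "w \<in> pts W" "x \<in> pts X" "d w = f x"
        from D(1) wx(1) show "(w, x) \<in> ?h ` pts W'"
        proof (cases rule: gcoproduct_cases)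
          case (1 y)
          with wx D have "(w, x) = ?h (i' x)"
            by (simp add: D' ui compose_eq)
          then show ?thesis
            using wx gmap_closed[OF C'(4)] by blast
        next
          case (2 y)
          with wx D have "(w, x) = ?h (j' x)"
            by (simp add: D' uj compose_eq)
          then show ?thesis
            using wx gmap_closed[OF C'(5)] by blast
        qed
      qed
    qed
  qed
  then have pb: "gpullback G W' W X Y d' d u f"
    using C C' D D' u f by (simp add: gpullback_def)
  let ?z = "pull W' W u z"
  have z': "?z \<in> M W'"
    using pull_in C C' u z by blast
  have za: "pull X W' i' ?z = pull X Y f a"
    using pull_comp[OF X C'(3) C(3) C'(4) u z(1)] pull_comp[OF X Y C(3) f C(4) z(1)] z by (simp add: i)
  have zb: "pull X W' j' ?z = pull X Y f b"
    using pull_comp[OF X C'(3) C(3) C'(5) u z(1)] pull_comp[OF X Y C(3) f C(5) z(1)] z by (simp add: j)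
  show "pull X Y f (a \<otimes>\<^bsub>mackey_monoid G M pull push Y\<^esub> b) =
      pull X Y f a \<otimes>\<^bsub>mackey_monoid G M pull push X\<^esub> pull X Y f b"
    using mackey_mult[OF F z(1)] mackey_mult[OF F' z'] base_change[OF pb z(1)] by (simp add: z za zb)
qed (use pull_in[OF X Y f] in \<open>simp add: mackey_monoid_def\<close>)

lemma free_eq_pull:
  assumes X: "fin_gset G X" and Y: "fin_gset G Y" and f: "f \<in> gmap G X Y"
    and a: "a \<in> M Y" and b: "b \<in> M Y" and ab: "free_eq G pull Y a b"
  shows "free_eq G pull X (pull X Y f a) (pull X Y f b)"
  unfolding free_eq_def
proof (intro allI impI)
  fix E :: "('g, 'x) gset" and \<gamma>
  assume E: "is_G_mod_e G E" and \<gamma>: "\<gamma> \<in> gmap G E X"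
  then have fE: "fin_gset G E"
    by (simp add: is_G_mod_e_def)
  show "pull E X \<gamma> (pull X Y f a) = pull E X \<gamma> (pull X Y f b)"
    using ab E gmap_compose[OF fE \<gamma> f]
    by (simp add: free_eq_def a b flip: pull_comp[OF fE X Y \<gamma> f])
qed

text \<open>The pull-back of \<open>f\<close> along a map from \<open>G/e\<close> has a free source, on which points are
  separated by the maps from \<open>G/e\<close>.\<close>

lemma free_eq_push:
  assumes X: "fin_gset G X" and Y: "fin_gset G Y" and f: "f \<in> gmap G X Y"
    and a: "a \<in> M X" and b: "b \<in> M X" and ab: "free_eq G pull X a b"
  shows "free_eq G pull Y (push X Y f a) (push X Y f b)"
  unfolding free_eq_def
proof (intro allI impI)
  fix E :: "('g, 'x) gset" and \<gamma>
  assume E: "is_G_mod_e G E" and \<gamma>: "\<gamma> \<in> gmap G E Y"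
  then have fE: "fin_gset G E"
    by (simp add: is_G_mod_e_def)
  obtain X' f' k where pb: "gpullback G X' X E Y f' f k \<gamma>"
    using gpullback_exists[OF X fE Y f \<gamma>] .
  then have X': "fin_gset G X'" and f': "f' \<in> gmap G X' E" and k: "k \<in> gmap G X' X"
    by (auto simp: gpullback_def)
  have "pull X' X k a = pull X' X k b"
  proof (rule eq_if_pull_orbits_eq[OF X'])
    show "pull X' X k a \<in> M X'" "pull X' X k b \<in> M X'"
      using pull_in[OF X' X k] a b by auto
    fix U :: "('g, 'x) gset" and h
    assume U: "transitive_gset G U" and h: "h \<in> gmap G U X'"
    then have fU: "fin_gset G U"
      by (simp add: transitive_gset_def)
    \<comment> \<open>The orbit maps to \<open>E\<close> by \<open>h\<close> followed by
      \<open>f'\<close>, so it is itself a copy of \<open>G/e\<close>, and \<open>h\<close> followed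
      by \<open>k\<close> is one of the maps to which \<open>ab\<close> applies.\<close>
    have "is_G_mod_e G U"
      using is_G_mod_e_if_gmap[OF E U gmap_compose[OF fU h f']] .
    then show "pull U X' h (pull X' X k a) = pull U X' h (pull X' X k b)"
      using ab gmap_compose[OF fU h k]
      by (simp add: free_eq_def a b flip: pull_comp[OF fU X' X h k])
  qed
  then show "pull E Y \<gamma> (push X Y f a) = pull E Y \<gamma> (push X Y f b)"
    using base_change[OF pb] a b by simp
qed

text \<open>\<open>G/e\<close> is transitive, so a map from it to a coproduct has its image in one
  summand and factors through that summand.\<close>

lemma free_eq_coproduct:
  assumes C: "gcoproduct G X Y W i j" and a: "a \<in> M W" and b: "b \<in> M W"
    and i: "free_eq G pull X (pull X W i a) (pull X W i b)"
    and j: "free_eq G pull Y (pull Y W j a) (pull Y W j b)"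
  shows "free_eq G pull W a b"
  unfolding free_eq_def
proof (intro allI impI)
  fix E :: "('g, 'x) gset" and \<gamma>
  assume E: "is_G_mod_e G E" and \<gamma>: "\<gamma> \<in> gmap G E W"
  note D = gcoproductD[OF C]
  have fE: "fin_gset G E"
    using E by (simp add: is_G_mod_e_def)
  note tE = is_G_mod_e_transitive[OF E]
  obtain e where e: "e \<in> pts E"
    using tE by (auto simp: transitive_gset_def)
  \<comment> \<open>Treats both summands at once. An equivariant map from \<open>E\<close> is
    determined by its value at \<open>e\<close>, so lifting that one value to \<open>V\<close> lifts
    \<open>\<gamma>\<close>.\<close>
  have factor: "pull E W \<gamma> a = pull E W \<gamma> b"
    if V: "fin_gset G V" and k: "k \<in> gmap G V W" and x: "x \<in> pts V" "\<gamma> e = k x"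
      and eq: "free_eq G pull V (pull V W k a) (pull V W k b)" for V k x
  proof -
    obtain h where h: "h \<in> gmap G E V" "h e = x"
      using is_G_mod_e_lift[OF E V e x(1)] .
    have "\<gamma> = compose (pts E) k h"
    proof (rule gmap_eqI[OF \<gamma> gmap_compose[OF fE h(1) k]])
      fix y
      assume y: "y \<in> pts E"
      obtain g where g: "g \<in> carrier G" "act E g e = y"
        using transitive_gsetD[OF tE e y] .
      have "\<gamma> (act E g e) = k (h (act E g e))"
        using g(1) e x h by (simp add: gmap_act[OF \<gamma>] gmap_act[OF h(1)] gmap_act[OF k])
      then show "\<gamma> y = compose (pts E) k h y"
        using y g by (simp add: compose_eq)
    qed
    then show ?thesis
      using eq E h by (simp add: free_eq_def pull_comp[OF fE V D(3) h(1) k] a b)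
  qed
  from C gmap_closed[OF \<gamma> e] show "pull E W \<gamma> a = pull E W \<gamma> b"
  proof (cases rule: gcoproduct_cases)
    case (1 x)
    then show ?thesis
      using factor[OF D(1) D(4) _ _ i] by blast
  next
    case (2 y)
    then show ?thesis
      using factor[OF D(2) D(5) _ _ j] by blast
  qed
qed

text \<open>Every map from \<open>G/e\<close> to a transitive \<open>G\<close>-set lifts to any nonempty \<open>G\<close>-set above it.\<close>

lemma free_eq_if_free_eq_pull:
  assumes X: "transitive_gset G X" and Y: "transitive_gset G Y" and f: "f \<in> gmap G X Y"
    and a: "a \<in> M Y" and b: "b \<in> M Y" and eq: "free_eq G pull X (pull X Y f a) (pull X Y f b)"
  shows "free_eq G pull Y a b"
  unfolding free_eq_def
proof (intro allI impI)
  fix E :: "('g, 'x) gset" and \<gamma>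
  assume E: "is_G_mod_e G E" and \<gamma>: "\<gamma> \<in> gmap G E Y"
  have fin: "fin_gset G E" "fin_gset G X" "fin_gset G Y"
    using E X Y by (auto simp: is_G_mod_e_def transitive_gset_def)
  note tE = is_G_mod_e_transitive[OF E]
  obtain e where e: "e \<in> pts E"
    using tE by (auto simp: transitive_gset_def)
  obtain x where x: "x \<in> pts X"
    using X by (auto simp: transitive_gset_def)
  \<comment> \<open>\<open>f x\<close> need not be \<open>\<gamma> e\<close>. Translating
    \<open>x\<close> by \<open>g\<close> corrects this, so the lift is made to start at
    \<open>act X g x\<close>.\<close>
  obtain g where g: "g \<in> carrier G" "act Y g (f x) = \<gamma> e"
    using transitive_gsetD[OF Y gmap_closed[OF f x] gmap_closed[OF \<gamma> e]] .
  obtain h where h: "h \<in> gmap G E X" "h e = act X g x"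
    using is_G_mod_e_lift[OF E fin(2) e act_closed[OF fin(2) g(1) x]] .
  have "\<gamma> = compose (pts E) f h"
  proof (rule gmap_eqI[OF \<gamma> gmap_compose[OF fin(1) h(1) f]])
    fix y
    assume y: "y \<in> pts E"
    obtain k where k: "k \<in> carrier G" "act E k e = y"
      using transitive_gsetD[OF tE e y] .
    have "f (h (act E k e)) = act Y k (f (h e))"
      using k(1) e by (simp add: gmap_act[OF h(1)] gmap_act[OF f] gmap_closed[OF h(1)])
    also have "\<dots> = \<gamma> (act E k e)"
      using k(1) e g x h by (simp add: gmap_act[OF f] gmap_act[OF \<gamma>])
    finally show "\<gamma> y = compose (pts E) f h y"
      using y k by (simp add: compose_eq)
  qed
  then show "pull E Y \<gamma> a = pull E Y \<gamma> b"
    using eq E h by (simp add: free_eq_def pull_comp[OF fin h(1) f] a b)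
qed

text \<open>Under (MRC), the restriction to each orbit is detected by a map from \<open>G/e\<close> to the orbit.\<close>

lemma eq_if_free_eq:
  assumes inj: "\<And>X Y f. \<lbrakk>transitive_gset G X; transitive_gset G Y; f \<in> gmap G X Y\<rbrakk> \<Longrightarrow> inj_on (pull X Y f) (M Y)"
    and X: "fin_gset G X" and a: "a \<in> M X" and b: "b \<in> M X" and ab: "free_eq G pull X a b"
  shows "a = b"
proof (rule eq_if_pull_orbits_eq[OF X a b])
  fix U :: "('g, 'x) gset" and f
  assume U: "transitive_gset G U" and f: "f \<in> gmap G U X"
  then have fU: "fin_gset G U"
    by (simp add: transitive_gset_def)
  obtain E :: "('g, 'x) gset" where E: "is_G_mod_e G E"
    using is_G_mod_e_exists[OF finite_group] by metis
  note tE = is_G_mod_e_transitive[OF E]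
  obtain e where e: "e \<in> pts E"
    using tE by (auto simp: transitive_gset_def)
  obtain x where x: "x \<in> pts U"
    using U by (auto simp: transitive_gset_def)
  obtain h where h: "h \<in> gmap G E U"
    using is_G_mod_e_lift[OF E fU e x] by metis
  have "pull E U h (pull U X f a) = pull E U h (pull U X f b)"
    using free_eq_pull[OF fU X f a b ab] E h by (simp add: free_eq_def)
  then show "pull U X f a = pull U X f b"
    using inj[OF tE U h] pull_in[OF fU X f] a b by (simp add: inj_on_def)
qed

end

section \<open>Transfer of semi-Mackey structure along natural families\<close>

lemma mackey_monoid_nat_hom:
  assumes "semi_mackey_infinite G M pull push" "semi_mackey_infinite G N pull' push'"
    and q: "\<And>X. fin_gset G X \<Longrightarrow> q X \<in> M X \<rightarrow> N X"
    and q_pull: "\<And>X Y f a. \<lbrakk>fin_gset G X; fin_gset G Y; f \<in> gmap G X Y; a \<in> M Y\<rbrakk>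
      \<Longrightarrow> q X (pull X Y f a) = pull' X Y f (q Y a)"
    and q_push: "\<And>X Y f a. \<lbrakk>fin_gset G X; fin_gset G Y; f \<in> gmap G X Y; a \<in> M X\<rbrakk>
      \<Longrightarrow> q Y (push X Y f a) = push' X Y f (q X a)"
    and X: "fin_gset G X"
  shows "q X \<in> hom (mackey_monoid G M pull push X) (mackey_monoid G N pull' push' X)"
    and "q X \<one>\<^bsub>mackey_monoid G M pull push X\<^esub> = \<one>\<^bsub>mackey_monoid G N pull' push' X\<^esub>"
proof -
  interpret M: semi_mackey_infinite G M pull push by fact
  interpret N: semi_mackey_infinite G N pull' push' by fact
  show "q X \<in> hom (mackey_monoid G M pull push X) (mackey_monoid G N pull' push' X)"
  proof (rule homI)
    fix a b
    assume "a \<in> carrier (mackey_monoid G M pull push X)" "b \<in> carrier (mackey_monoid G M pull push X)"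
    then have ab: "a \<in> M X" "b \<in> M X"
      by (simp_all add: mackey_monoid_def)
    obtain W i j d where F: "is_fold G X W i j d"
      using M.fold_exists[OF X] .
    note D = is_foldD[OF F]
    note C = gcoproductD[OF D(1)]
    obtain z where z: "z \<in> M W" "pull X W i z = a" "pull X W j z = b"
      using M.coproduct_glue[OF D(1) ab] .
    \<comment> \<open>\<open>q\<close> changes values but not \<open>G\<close>-sets: the same
      folding diagram computes both products, with \<open>q W z\<close> in place of
      \<open>z\<close>.\<close>
    have qz: "q W z \<in> N W"
      using q[OF C(3)] z by blast
    show "q X (a \<otimes>\<^bsub>mackey_monoid G M pull push X\<^esub> b) =
        q X a \<otimes>\<^bsub>mackey_monoid G N pull' push' X\<^esub> q X b"
      using M.mackey_mult[OF F z(1)] N.mackey_mult[OF F qz] z(1) q_push[OF C(3) X D(2) z(1)]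
        q_pull[OF X C(3) C(4) z(1)] q_pull[OF X C(3) C(5) z(1)]
      by (simp add: z)
  qed (use q[OF X] in \<open>auto simp: mackey_monoid_def\<close>)
  let ?z = "THE z. z \<in> M gempty"
  have z: "?z \<in> M gempty" "q gempty ?z \<in> N gempty"
    using M.gempty_element q[OF M.fin_gset_gempty] by auto
  show "q X \<one>\<^bsub>mackey_monoid G M pull push X\<^esub> = \<one>\<^bsub>mackey_monoid G N pull' push' X\<^esub>"
    unfolding M.mackey_one[OF z(1)] N.mackey_one[OF z(2)]
    using q_push[OF M.fin_gset_gempty X M.gempty_gmap z(1)] .
qed

text \<open>Equations pass along a surjective natural family. That the two summands of a coproduct
  separate elements is not an equation and may fail in an image, hence the hypothesis
  \<open>q_coproduct\<close>.\<close>

lemma semi_mackey_image: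
  assumes "semi_mackey G M pull push"
    and q: "\<And>X. fin_gset G X \<Longrightarrow> q X ` M X = N X"
    and q_pull: "\<And>X Y f a. \<lbrakk>fin_gset G X; fin_gset G Y; f \<in> gmap G X Y; a \<in> M Y\<rbrakk>
      \<Longrightarrow> q X (pull X Y f a) = pull' X Y f (q Y a)"
    and q_push: "\<And>X Y f a. \<lbrakk>fin_gset G X; fin_gset G Y; f \<in> gmap G X Y; a \<in> M X\<rbrakk>
      \<Longrightarrow> q Y (push X Y f a) = push' X Y f (q X a)"
    and q_coproduct: "\<And>X Y W i j a b. \<lbrakk>gcoproduct G X Y W i j; a \<in> M W; b \<in> M W;
      q X (pull X W i a) = q X (pull X W i b); q Y (pull Y W j a) = q Y (pull Y W j b)\<rbrakk>
      \<Longrightarrow> q W a = q W b"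
  shows "semi_mackey G N pull' push'"
proof -
  interpret M: semi_mackey G M pull push by fact
  have q_in: "q X a \<in> N X" if "fin_gset G X" "a \<in> M X" for X a
    using q that by blast
  \<comment> \<open>Oriented to move \<open>q\<close> outwards, so that an equation over
    \<open>N\<close> becomes \<open>q\<close> applied to one known over \<open>M\<close>.\<close>
  note comm = q_pull[symmetric] q_push[symmetric]
  show ?thesis
  proof (unfold_locales, goal_cases)
    case (1 X Y f)
    then show ?case by (auto simp: comm M.pull_in intro!: imageI simp flip: q)
  next
    case (2 X Y f)
    then show ?case by (auto simp: comm M.push_in intro!: imageI simp flip: q)
  next
    case (3 X a)
    then show ?case by (auto simp: comm M.pull_id gid_gmap intro!: imageI simp flip: q)
  next
    case (4 X a)
    then show ?case by (auto simp: comm M.push_id gid_gmap intro!: imageI simp flip: q)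
  next
    case (5 X Y Z f h a)
    then show ?case by (auto simp: comm M.pull_comp M.pull_in gmap_compose intro!: imageI simp flip: q)
  next
    case (6 X Y Z f h a)
    then show ?case by (auto simp: comm M.push_comp M.push_in gmap_compose intro!: imageI simp flip: q)
  next
    case (7 X)
    from M.empty_to_point[OF 7] obtain a where "M X = {a}"
      by auto
    then have "N X = {q X a}"
      using q[OF 7(1)] by auto
    then show ?case
      by simp
  next
    case C: (8 X Y W i j)
    note D = gcoproductD[OF C]
    show ?case
      unfolding bij_betw_def
    proof
      show "inj_on (\<lambda>a. (pull' X W i a, pull' Y W j a)) (N W)"
      proof (rule inj_onI)
        fix a b
        assume "a \<in> N W" "b \<in> N W"
          and eq: "(pull' X W i a, pull' Y W j a) = (pull' X W i b, pull' Y W j b)"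
        then obtain a' b' where "a' \<in> M W" "b' \<in> M W" "a = q W a'" "b = q W b'"
          unfolding q[OF D(3), symmetric] by blast
        with eq show "a = b"
          using q_coproduct[OF C, of a' b'] D by (simp add: comm)
      qed
      show "(\<lambda>a. (pull' X W i a, pull' Y W j a)) ` N W = N X \<times> N Y"
      proof
        show "(\<lambda>a. (pull' X W i a, pull' Y W j a)) ` N W \<subseteq> N X \<times> N Y"
          using D by (auto simp: comm M.pull_in simp flip: q)
        show "N X \<times> N Y \<subseteq> (\<lambda>a. (pull' X W i a, pull' Y W j a)) ` N W"
        proof clarify
          fix a b
          assume "a \<in> N X" "b \<in> N Y"
          then obtain a' b' where ab: "a' \<in> M X" "b' \<in> M Y" "a = q X a'" "b = q Y b'"
            unfolding q[OF D(1), symmetric] q[OF D(2), symmetric] by blast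
          obtain z where z: "z \<in> M W" "pull X W i z = a'" "pull Y W j z = b'"
            using M.coproduct_glue[OF C ab(1,2)] .
          have "(a, b) = (pull' X W i (q W z), pull' Y W j (q W z))"
            using D z ab by (simp add: comm)
          then show "(a, b) \<in> (\<lambda>a. (pull' X W i a, pull' Y W j a)) ` N W"
            using q_in[OF D(3) z(1)] by blast
        qed
      qed
    qed
  next
    case (9 X' X Y' Y f' f k h a)
    note pb = 9(1)
    have D: "fin_gset G X'" "fin_gset G X" "fin_gset G Y'" "fin_gset G Y"
      "f' \<in> gmap G X' Y'" "f \<in> gmap G X Y" "k \<in> gmap G X' X" "h \<in> gmap G Y' Y"
      using pb by (auto simp: gpullback_def)
    obtain b where b: "b \<in> M X" "a = q X b"
      using 9(2) unfolding q[OF D(2), symmetric] by blast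
    show ?case
      using D b M.base_change[OF pb b(1)] by (simp add: comm M.pull_in M.push_in)
  qed
qed

section \<open>Images of Tambara functors\<close>

text \<open>A morphism without extensionality and without the ring conditions; between Tambara
  functors the latter are consequences.\<close>

definition tam_nat ::
    "('g, 'b) monoid_scheme \<Rightarrow> ('g, 'x, 'u) tambara \<Rightarrow> ('g, 'x, 'v) tambara
      \<Rightarrow> (('g, 'x) gset \<Rightarrow> 'u \<Rightarrow> 'v) \<Rightarrow> bool" where
  "tam_nat G T S q \<longleftrightarrow>
     (\<forall>X. fin_gset G X \<longrightarrow> q X \<in> val T X \<rightarrow> val S X) \<and>
     (\<forall>X Y f. fin_gset G X \<longrightarrow> fin_gset G Y \<longrightarrow> f \<in> gmap G X Y \<longrightarrow>
        (\<forall>b\<in>val T Y. q X (res T X Y f b) = res S X Y f (q Y b)) \<and>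
        (\<forall>a\<in>val T X. q Y (trn T X Y f a) = trn S X Y f (q X a)) \<and>
        (\<forall>a\<in>val T X. q Y (nrm T X Y f a) = nrm S X Y f (q X a)))"

lemma tam_natD:
  assumes "tam_nat G T S q" "fin_gset G X"
  shows "a \<in> val T X \<Longrightarrow> q X a \<in> val S X"
    and "\<lbrakk>fin_gset G Y; f \<in> gmap G X Y; b \<in> val T Y\<rbrakk> \<Longrightarrow> q X (res T X Y f b) = res S X Y f (q Y b)"
    and "\<lbrakk>fin_gset G Y; f \<in> gmap G X Y; a \<in> val T X\<rbrakk> \<Longrightarrow> q Y (trn T X Y f a) = trn S X Y f (q X a)"
    and "\<lbrakk>fin_gset G Y; f \<in> gmap G X Y; a \<in> val T X\<rbrakk> \<Longrightarrow> q Y (nrm T X Y f a) = nrm S X Y f (q X a)"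
  using assms unfolding tam_nat_def by (simp_all add: Pi_iff)

lemma tambara_semi_mackey:
  fixes T :: "('g, 'x::infinite, 'u) tambara"
  assumes "finite (carrier G)" "tambara_functor G T"
  shows "semi_mackey_infinite G (val T) (res T) (trn T)" "semi_mackey_infinite G (val T) (res T) (nrm T)"
  using assms
  by (auto simp: tambara_functor_def semi_mackey_infinite_def semi_mackey_infinite_axioms_def mackey_def)

lemma tambara_closed:
  assumes "tambara_functor G T" "fin_gset G X" "fin_gset G Y" "f \<in> gmap G X Y"
  shows "b \<in> val T Y \<Longrightarrow> res T X Y f b \<in> val T X"
    and "a \<in> val T X \<Longrightarrow> trn T X Y f a \<in> val T Y"
    and "a \<in> val T X \<Longrightarrow> nrm T X Y f a \<in> val T Y"
proof -
  have "semi_mackey G (val T) (res T) (trn T)" "semi_mackey G (val T) (res T) (nrm T)"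
    using assms(1) by (auto simp: tambara_functor_def mackey_def)
  note this[THEN semi_mackey.pull_in[OF _ assms(2-)]] this[THEN semi_mackey.push_in[OF _ assms(2-)]]
  then show "b \<in> val T Y \<Longrightarrow> res T X Y f b \<in> val T X" "a \<in> val T X \<Longrightarrow> trn T X Y f a \<in> val T Y"
    "a \<in> val T X \<Longrightarrow> nrm T X Y f a \<in> val T Y"
    by simp_all
qed

text \<open>Addition and multiplication are the \<open>mackey_monoid\<close> operations of
  \<open>trn\<close> and \<open>nrm\<close>, so naturality alone makes each component a ring
  homomorphism.\<close>

lemma tam_nat_ring_hom:
  fixes T :: "('g, 'x::infinite, 'u) tambara" and S :: "('g, 'x, 'v) tambara"
  assumes fin: "finite (carrier G)" and T: "tambara_functor G T" and S: "tambara_functor G S"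
    and q: "tam_nat G T S q" and X: "fin_gset G X"
  shows "q X \<in> ring_hom (tam_ring G T X) (tam_ring G S X)"
proof -
  note tr = mackey_monoid_nat_hom[OF tambara_semi_mackey(1)[OF fin T] tambara_semi_mackey(1)[OF fin S], of q, OF _ _ _ X]
  note nr = mackey_monoid_nat_hom[OF tambara_semi_mackey(2)[OF fin T] tambara_semi_mackey(2)[OF fin S], of q, OF _ _ _ X]
  have "q X \<in> hom (mackey_monoid G (val T) (res T) (trn T) X) (mackey_monoid G (val S) (res S) (trn S) X)"
    using tam_natD[OF q] by (intro tr) auto
  moreover have "q X \<in> hom (mackey_monoid G (val T) (res T) (nrm T) X) (mackey_monoid G (val S) (res S) (nrm S) X)"
    "q X \<one>\<^bsub>mackey_monoid G (val T) (res T) (nrm T) X\<^esub> = \<one>\<^bsub>mackey_monoid G (val S) (res S) (nrm S) X\<^esub>"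
    using tam_natD[OF q] by (intro nr; auto)+
  ultimately show ?thesis
    by (auto simp: ring_hom_def hom_def tam_ring_def mackey_monoid_def)
qed

lemma tambara_image:
  fixes T :: "('g, 'x::infinite, 'u) tambara" and S :: "('g, 'x, 'v) tambara"
  assumes fin: "finite (carrier G)" and T: "tambara_functor G T" and q: "tam_nat G T S q"
    and surj: "\<And>X. fin_gset G X \<Longrightarrow> q X ` val T X = val S X"
    and coprod: "\<And>X Y W i j a b. \<lbrakk>gcoproduct G X Y W i j; a \<in> val T W; b \<in> val T W;
      q X (res T X W i a) = q X (res T X W i b); q Y (res T Y W j a) = q Y (res T Y W j b)\<rbrakk>
      \<Longrightarrow> q W a = q W b"
  shows "tambara_functor G S"
proof -
  have "semi_mackey G (val T) (res T) (trn T)" "semi_mackey G (val T) (res T) (nrm T)"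
    using T by (auto simp: tambara_functor_def mackey_def)
  from this[THEN semi_mackey_image[where q = q, OF _ surj _ _ coprod]]
  have trn: "semi_mackey G (val S) (res S) (trn S)" and nrm: "semi_mackey G (val S) (res S) (nrm S)"
    using tam_natD[OF q] by simp_all
  note sT = tambara_semi_mackey(1)[OF fin T]
  have sS: "semi_mackey_infinite G (val S) (res S) (trn S)"
    using trn fin by (simp add: semi_mackey_infinite_def semi_mackey_infinite_axioms_def)
  have "comm_group (mackey_monoid G (val S) (res S) (trn S) X)" if X: "fin_gset G X" for X
  proof -
    let ?MT = "mackey_monoid G (val T) (res T) (trn T) X"
    let ?MS = "mackey_monoid G (val S) (res S) (trn S) X"
    have "comm_group ?MT"
      using T X by (auto simp: tambara_functor_def mackey_def mackey_axioms_def)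
    moreover have "q X \<in> hom ?MT ?MS" and one: "q X \<one>\<^bsub>?MT\<^esub> = \<one>\<^bsub>?MS\<^esub>"
      using tam_natD[OF q] by (intro mackey_monoid_nat_hom[OF sT sS _ _ _ X]; auto)+
    \<comment> \<open>The image group has the image of the unit as its unit; by \<open>one\<close>
      and surjectivity this record is \<open>?MS\<close> itself.\<close>
    ultimately have "comm_group (?MS\<lparr>carrier := q X ` carrier ?MT, one := \<one>\<^bsub>?MS\<^esub>\<rparr>)"
      using comm_group.hom_imp_img_comm_group by (metis one)
    then show ?thesis
      using surj[OF X] by (simp add: mackey_monoid_def)
  qed
  moreover have "nrm S X Y f (trn S A X p a) = trn S Q Y k (nrm S Z Q r (res S Z A l a))"
    if E: "exponential_diagram G A X Y p f Z Q l r k" and a: "a \<in> val S A" for A X Y p f Z Q l r k a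
  proof -
    have D: "fin_gset G A" "fin_gset G X" "fin_gset G Y" "fin_gset G Z" "fin_gset G Q"
      "p \<in> gmap G A X" "f \<in> gmap G X Y" "l \<in> gmap G Z A" "r \<in> gmap G Z Q" "k \<in> gmap G Q Y"
      using E by (auto simp: exponential_diagram_def)
    obtain b where b: "b \<in> val T A" "a = q A b"
      using a unfolding surj[OF D(1), symmetric] by blast
    have "nrm T X Y f (trn T A X p b) = trn T Q Y k (nrm T Z Q r (res T Z A l b))"
      using T E b by (auto simp: tambara_functor_def)
    then have "q Y (nrm T X Y f (trn T A X p b)) = q Y (trn T Q Y k (nrm T Z Q r (res T Z A l b)))"
      by simp
    then show ?thesis
      using D b by (simp add: tam_natD[OF q] tambara_closed[OF T])
  qed
  ultimately show ?thesis
    using trn nrm by (auto simp: tambara_functor_def mackey_def mackey_axioms_def)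
qed

text \<open>By surjectivity, naturality of \<open>h\<close> can be checked on elements
  \<open>q X a\<close>, where it is naturality of \<open>k\<close>. Both the action on morphisms and
  the universal property rest on this.\<close>

lemma tam_nat_factor:
  fixes T :: "('g, 'x, 'u) tambara" and S :: "('g, 'x, 'v) tambara" and R :: "('g, 'x, 'w) tambara"
  assumes T: "tambara_functor G T" and q: "tam_nat G T S q"
    and surj: "\<And>X. fin_gset G X \<Longrightarrow> q X ` val T X = val S X"
    and k: "tam_nat G T R k"
    and h: "\<And>X a. \<lbrakk>fin_gset G X; a \<in> val T X\<rbrakk> \<Longrightarrow> h X (q X a) = k X a"
  shows "tam_nat G S R h"
  unfolding tam_nat_def
proof (intro conjI allI impI ballI)
  fix X :: "('g, 'x) gset"
  assume "fin_gset G X"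
  then show "h X \<in> val S X \<rightarrow> val R X"
    by (auto simp: h tam_natD[OF k] simp flip: surj)
next
  fix X Y :: "('g, 'x) gset" and f b
  assume *: "fin_gset G X" "fin_gset G Y" "f \<in> gmap G X Y" "b \<in> val S Y"
  then obtain c where c: "c \<in> val T Y" "b = q Y c"
    unfolding surj[OF *(2), symmetric] by blast
  then show "h X (res S X Y f b) = res R X Y f (h Y b)"
    using * by (simp add: h tambara_closed[OF T] tam_natD[OF k] flip: tam_natD(2)[OF q])
next
  fix X Y :: "('g, 'x) gset" and f a
  assume *: "fin_gset G X" "fin_gset G Y" "f \<in> gmap G X Y" "a \<in> val S X"
  then obtain c where c: "c \<in> val T X" "a = q X c"
    unfolding surj[OF *(1), symmetric] by blast
  then show "h Y (trn S X Y f a) = trn R X Y f (h X a)" "h Y (nrm S X Y f a) = nrm R X Y f (h X a)"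
    using * by (simp_all add: h tambara_closed[OF T] tam_natD[OF k] flip: tam_natD(3,4)[OF q])
qed

lemma tam_nat_compose:
  assumes q: "tam_nat G T S q" and k: "tam_nat G S R k"
  shows "tam_nat G T R (\<lambda>X a. k X (q X a))"
  unfolding tam_nat_def by (auto simp: tam_natD[OF q] tam_natD[OF k])

lemma transport_nat:
  assumes "\<And>X. fin_gset G X \<Longrightarrow> inj_on e (val T X)"
  shows "tam_nat G T (transport e T) (\<lambda>X. e)"
  using assms by (auto simp: tam_nat_def transport_def)

lemma tambara_transport:
  fixes T :: "('g, 'x::infinite, 'u) tambara" and e :: "'u \<Rightarrow> 'v"
  assumes fin: "finite (carrier G)" and T: "tambara_functor G T"
    and inj: "\<And>X. fin_gset G X \<Longrightarrow> inj_on e (val T X)"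
  shows "tambara_functor G (transport e T)"
proof (rule tambara_image[OF fin T transport_nat])
  show "inj_on e (val T X)" if "fin_gset G X" for X
    by (rule inj[OF that])
  show "e ` val T X = val (transport e T) X" for X
    by (simp add: transport_def)
  fix X Y W i j a b
  assume C: "gcoproduct G X Y W i j" and ab: "a \<in> val T W" "b \<in> val T W"
    and eq: "e (res T X W i a) = e (res T X W i b)" "e (res T Y W j a) = e (res T Y W j b)"
  note D = gcoproductD[OF C]
  have M: "semi_mackey G (val T) (res T) (nrm T)"
    using T by (simp add: tambara_functor_def)
  have "res T X W i a = res T X W i b"
    using eq(1) inj[OF D(1)] ab tambara_closed(1)[OF T D(1) D(3) D(4)] by (auto simp: inj_on_eq_iff)
  moreover have "res T Y W j a = res T Y W j b"
    using eq(2) inj[OF D(2)] ab tambara_closed(1)[OF T D(2) D(3) D(5)] by (auto simp: inj_on_eq_iff)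
  ultimately show "e a = e b"
    using semi_mackey.coproduct_eqI[OF M C ab] by simp
qed

lemma MRC_transport:
  fixes T :: "('g, 'x, 'u) tambara"
  assumes T: "tambara_functor G T" and MRC: "MRC G T"
    and inj: "\<And>X. fin_gset G X \<Longrightarrow> inj_on e (val T X)"
  shows "MRC G (transport e T)"
  unfolding MRC_def
proof (intro allI impI)
  fix X Y :: "('g, 'x) gset" and f
  assume *: "transitive_gset G X" "transitive_gset G Y" "f \<in> gmap G X Y"
  then have fin: "fin_gset G X" "fin_gset G Y"
    by (auto simp: transitive_gset_def)
  have "inj_on (res T X Y f) (val T Y)"
    using MRC * by (auto simp: MRC_def)
  moreover have "inj_on e (res T X Y f ` val T Y)"
    using * fin by (intro inj_on_subset[OF inj[OF fin(1)]]) (auto simp: tambara_closed[OF T])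
  ultimately have "inj_on (\<lambda>b. e (res T X Y f b)) (val T Y)"
    using comp_inj_on by (fastforce simp: comp_def)
  then show "inj_on (res (transport e T) X Y f) (val (transport e T) Y)"
    using inj[OF fin(2)] by (simp add: transport_def inj_on_def) metis
qed

section \<open>The quotient by \<open>\<I>\<^bsub>(0)\<^esub>\<close>\<close>

definition zero_coset ::
    "('g, 'b) monoid_scheme \<Rightarrow> ('g, 'x, 'u) tambara \<Rightarrow> ('g, 'x) gset \<Rightarrow> 'u \<Rightarrow> 'u set" where
  "zero_coset G T X a = ideal_zero G T X +>\<^bsub>tam_ring G T X\<^esub> a"

text \<open>The unit of the adjunction at \<open>T\<close>. Its values are representatives, so they
  lie both in \<open>val T X\<close> and in \<open>val (tam_MRC G T) X\<close>.\<close>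

definition mrc_proj ::
    "('g, 'b) monoid_scheme \<Rightarrow> ('g, 'x, 'u) tambara \<Rightarrow> ('g, 'x, 'u) family" where
  "mrc_proj G T X a = coset_rep (zero_coset G T X a)"

locale finite_tambara = group G
  for G :: "('g, 'b) monoid_scheme" (structure) and T :: "('g, 'x::infinite, 'u) tambara" +
  assumes finite_group: "finite (carrier G)"
    and tambara: "tambara_functor G T"
begin

sublocale add: semi_mackey_infinite G "val T" "res T" "trn T"
  using tambara_semi_mackey(1)[OF finite_group tambara] .

sublocale mul: semi_mackey_infinite G "val T" "res T" "nrm T"
  using tambara_semi_mackey(2)[OF finite_group tambara] .

abbreviation "Q \<equiv> tam_quotient G T (ideal_zero G T)"

abbreviation "eqv \<equiv> free_eq G (res T)"

lemma eqv_refl: "eqv X a a"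
  and eqv_sym: "eqv X a b \<Longrightarrow> eqv X b a"
  and eqv_trans: "eqv X a b \<Longrightarrow> eqv X b c \<Longrightarrow> eqv X a c"
  by (auto simp: free_eq_def)

text \<open>\<open>i \<oplus> a\<close> and \<open>a\<close> have equal restrictions to
  \<open>G/e\<close> exactly when those of \<open>i\<close> vanish. This uses additivity of
  restriction and cancellation in the additive groups.\<close>

lemma zero_coset_eq:
  assumes X: "fin_gset G X" and a: "a \<in> val T X"
  shows "zero_coset G T X a = {b \<in> val T X. eqv X a b}"
proof -
  have grp: "comm_group (add_monoid (tam_ring G T Y))" if "fin_gset G Y" for Y
  proof -
    have "comm_group (mackey_monoid G (val T) (res T) (trn T) Y)"
      using tambara that by (auto simp: tambara_functor_def mackey_def mackey_axioms_def)
    then show ?thesis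
      by (simp add: tam_ring_def mackey_monoid_def)
  qed
  have hom: "res T E X \<gamma> \<in> hom (add_monoid (tam_ring G T X)) (add_monoid (tam_ring G T E))"
    if "is_G_mod_e G E" "\<gamma> \<in> gmap G E X" for E \<gamma>
    using add.pull_hom[of E X \<gamma>] that X
    by (simp add: is_G_mod_e_def tam_ring_def hom_def mackey_monoid_def)
  let ?R = "tam_ring G T X"
  have car: "carrier (tam_ring G T Y) = val T Y" for Y
    by (simp add: tam_ring_def)
  interpret R: comm_group "add_monoid ?R"
    by (rule grp[OF X])
  show ?thesis
  proof (intro subset_antisym subsetI)
    fix b
    assume "b \<in> zero_coset G T X a"
    then obtain i where i: "i \<in> ideal_zero G T X" "b = i \<oplus>\<^bsub>?R\<^esub> a"
      by (auto simp: zero_coset_def a_r_coset_def')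
    then have iT: "i \<in> val T X"
      by (simp add: ideal_zero_def)
    have "res T E X \<gamma> a = res T E X \<gamma> b" if E: "is_G_mod_e G E" and \<gamma>: "\<gamma> \<in> gmap G E X" for E \<gamma>
    proof -
      have fE: "fin_gset G E"
        using E by (simp add: is_G_mod_e_def)
      interpret E: comm_group "add_monoid (tam_ring G T E)"
        by (rule grp[OF fE])
      have "res T E X \<gamma> b = \<zero>\<^bsub>tam_ring G T E\<^esub> \<oplus>\<^bsub>tam_ring G T E\<^esub> res T E X \<gamma> a"
        using hom_mult[OF hom[OF E \<gamma>], of i a] i iT a E \<gamma> by (simp add: car ideal_zero_def)
      then show ?thesis
        using E.l_one[of "res T E X \<gamma> a"] add.pull_in[OF fE X \<gamma> a] by (simp add: car)
    qed
    then show "b \<in> {b \<in> val T X. eqv X a b}"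
      using i iT a R.m_closed[of i a] by (auto simp: free_eq_def car)
  next
    fix b
    assume "b \<in> {b \<in> val T X. eqv X a b}"
    then have b: "b \<in> val T X" and ab: "eqv X a b"
      by auto
    \<comment> \<open>\<open>i\<close> is \<open>b\<close> minus \<open>a\<close>, with the inverse
      taken in \<open>add_monoid ?R\<close>.\<close>
    obtain i where i: "i \<in> val T X" "i \<oplus>\<^bsub>?R\<^esub> a = b"
      using R.inv_solve_right'[of b _ a] R.m_closed[of b "inv\<^bsub>add_monoid ?R\<^esub> a"] R.inv_closed[of a]
        R.inv_solve_right[of "b \<otimes>\<^bsub>add_monoid ?R\<^esub> inv\<^bsub>add_monoid ?R\<^esub> a" b a] a b
      by (auto simp: car)
    have "res T E X \<gamma> i = \<zero>\<^bsub>tam_ring G T E\<^esub>" if E: "is_G_mod_e G E" and \<gamma>: "\<gamma> \<in> gmap G E X" for E \<gamma>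
    proof -
      have fE: "fin_gset G E"
        using E by (simp add: is_G_mod_e_def)
      interpret E: comm_group "add_monoid (tam_ring G T E)"
        by (rule grp[OF fE])
      have "res T E X \<gamma> i \<oplus>\<^bsub>tam_ring G T E\<^esub> res T E X \<gamma> a = res T E X \<gamma> b"
        using hom_mult[OF hom[OF E \<gamma>], of i a] i a by (simp add: car)
      also have "\<dots> = res T E X \<gamma> a"
        using ab E \<gamma> by (simp add: free_eq_def)
      finally show ?thesis
        using E.r_cancel_one[of "res T E X \<gamma> a" "res T E X \<gamma> i"] add.pull_in[OF fE X \<gamma>] a i by (simp add: car)
    qed
    then have "i \<in> ideal_zero G T X"
      using i by (simp add: ideal_zero_def)
    then show "b \<in> zero_coset G T X a"
      using i by (auto simp: zero_coset_def a_r_coset_def')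
  qed
qed

lemma zero_coset_eq_iff:
  assumes "fin_gset G X" "a \<in> val T X" "b \<in> val T X"
  shows "zero_coset G T X a = zero_coset G T X b \<longleftrightarrow> eqv X a b"
proof
  assume "zero_coset G T X a = zero_coset G T X b"
  moreover have "b \<in> zero_coset G T X b"
    using assms by (simp add: zero_coset_eq eqv_refl)
  ultimately have "b \<in> zero_coset G T X a"
    by simp
  then show "eqv X a b"
    using assms by (simp add: zero_coset_eq)
next
  assume "eqv X a b"
  then show "zero_coset G T X a = zero_coset G T X b"
    using assms by (auto simp: zero_coset_eq dest: eqv_trans eqv_sym)
qed

lemma val_quotient: "val Q X = zero_coset G T X ` val T X"
  by (auto simp: tam_quotient_def FactRing_def A_RCOSETS_def' zero_coset_def tam_ring_def)

text \<open>All cosets in the union coincide, so \<open>induced\<close> returns that coset. As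
  \<open>h\<close> may land in another functor \<open>S\<close>, this covers the structure maps of
  the quotient as well as the maps induced by morphisms.\<close>

lemma induced_zero_coset:
  assumes Y: "fin_gset G Y" and a: "a \<in> val T Y"
    and h: "\<And>b. \<lbrakk>b \<in> val T Y; eqv Y a b\<rbrakk> \<Longrightarrow> zero_coset G S X (h b) = zero_coset G S X (h a)"
  shows "induced (tam_ring G S X) (ideal_zero G S X) h (zero_coset G T Y a) = zero_coset G S X (h a)"
proof -
  have "zero_coset G T Y a \<noteq> {}"
    using a eqv_refl by (auto simp: zero_coset_eq[OF Y])
  moreover have "zero_coset G S X (h b) = zero_coset G S X (h a)" if "b \<in> zero_coset G T Y a" for b
    using that h by (simp add: zero_coset_eq[OF Y a])
  ultimately show ?thesis
    by (auto simp: induced_def simp flip: zero_coset_def)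
qed

lemma quotient_nat: "tam_nat G T Q (zero_coset G T)"
  unfolding tam_nat_def
proof (intro conjI allI impI ballI)
  show "zero_coset G T X \<in> val T X \<rightarrow> val Q X" for X
    by (auto simp: val_quotient)
next
  fix X Y :: "('g, 'x) gset" and f b
  assume *: "fin_gset G X" "fin_gset G Y" "f \<in> gmap G X Y" "b \<in> val T Y"
  then show "zero_coset G T X (res T X Y f b) = res Q X Y f (zero_coset G T Y b)"
    using add.free_eq_pull[OF *(1-3)]
    by (simp add: tam_quotient_def induced_zero_coset zero_coset_eq_iff add.pull_in eqv_sym)
next
  fix X Y :: "('g, 'x) gset" and f a
  assume *: "fin_gset G X" "fin_gset G Y" "f \<in> gmap G X Y" "a \<in> val T X"
  then show "zero_coset G T Y (trn T X Y f a) = trn Q X Y f (zero_coset G T X a)"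
    using add.free_eq_push[OF *(1-3)]
    by (simp add: tam_quotient_def induced_zero_coset zero_coset_eq_iff add.push_in eqv_sym)
  show "zero_coset G T Y (nrm T X Y f a) = nrm Q X Y f (zero_coset G T X a)"
    using * mul.free_eq_push[OF *(1-3)]
    by (simp add: tam_quotient_def induced_zero_coset zero_coset_eq_iff mul.push_in eqv_sym)
qed

lemma tambara_quotient: "tambara_functor G Q"
proof (rule tambara_image[OF finite_group tambara quotient_nat])
  show "zero_coset G T X ` val T X = val Q X" for X
    by (simp add: val_quotient)
  fix X Y W i j a b
  assume C: "gcoproduct G X Y W i j" and ab: "a \<in> val T W" "b \<in> val T W"
    and "zero_coset G T X (res T X W i a) = zero_coset G T X (res T X W i b)"
      "zero_coset G T Y (res T Y W j a) = zero_coset G T Y (res T Y W j b)"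
  with gcoproductD[OF C] show "zero_coset G T W a = zero_coset G T W b"
    using add.free_eq_coproduct[OF C ab] by (simp add: zero_coset_eq_iff add.pull_in)
qed

text \<open>Equality in the quotient after restriction to \<open>X\<close> is equivalence of
  restrictions in \<open>T\<close>, which descends to \<open>Y\<close> because maps from
  \<open>G/e\<close> to \<open>Y\<close> lift to \<open>X\<close>.\<close>

lemma MRC_quotient: "MRC G Q"
  unfolding MRC_def
proof (intro allI impI inj_onI)
  fix X Y :: "('g, 'x) gset" and f c d
  assume *: "transitive_gset G X" "transitive_gset G Y" "f \<in> gmap G X Y"
    and "c \<in> val Q Y" "d \<in> val Q Y" and eq: "res Q X Y f c = res Q X Y f d"
  then obtain a b where ab: "a \<in> val T Y" "b \<in> val T Y" "c = zero_coset G T Y a" "d = zero_coset G T Y b"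
    unfolding val_quotient by blast
  have fin: "fin_gset G X" "fin_gset G Y"
    using * by (auto simp: transitive_gset_def)
  have "eqv X (res T X Y f a) (res T X Y f b)"
    using eq fin *(3) ab by (simp add: zero_coset_eq_iff add.pull_in flip: tam_natD(2)[OF quotient_nat])
  then show "c = d"
    using add.free_eq_if_free_eq_pull[OF * ab(1,2)] fin ab by (simp add: zero_coset_eq_iff)
qed

lemma mrc_proj_in:
  assumes X: "fin_gset G X" and a: "a \<in> val T X"
  shows "mrc_proj G T X a \<in> val T X" and "eqv X a (mrc_proj G T X a)"
proof -
  have "a \<in> zero_coset G T X a"
    using a eqv_refl by (simp add: zero_coset_eq[OF X])
  then have "mrc_proj G T X a \<in> zero_coset G T X a"
    unfolding mrc_proj_def coset_rep_def by (rule someI)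
  then show "mrc_proj G T X a \<in> val T X" "eqv X a (mrc_proj G T X a)"
    by (auto simp: zero_coset_eq[OF X a])
qed

text \<open>A representative lies in its coset and distinct classes are disjoint, so it determines
  the coset. This licenses moving the quotient to representatives.\<close>

lemma inj_coset_rep:
  assumes X: "fin_gset G X"
  shows "inj_on coset_rep (val Q X)"
proof (rule inj_onI)
  fix c d
  assume "c \<in> val Q X" "d \<in> val Q X" and eq: "coset_rep c = coset_rep d"
  then obtain a b where ab: "a \<in> val T X" "b \<in> val T X" "c = zero_coset G T X a" "d = zero_coset G T X b"
    unfolding val_quotient by blast
  then have "mrc_proj G T X a = mrc_proj G T X b"
    using eq by (simp add: mrc_proj_def)
  then have "eqv X a b"
    using mrc_proj_in(2)[OF X] ab eqv_trans eqv_sym by metis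
  then show "c = d"
    using ab X by (simp add: zero_coset_eq_iff)
qed

lemma tambara_MRC: "tambara_functor G (tam_MRC G T)"
  unfolding tam_MRC_def by (rule tambara_transport[OF finite_group tambara_quotient inj_coset_rep])

lemma MRC_MRC: "MRC G (tam_MRC G T)"
  unfolding tam_MRC_def by (rule MRC_transport[OF tambara_quotient MRC_quotient inj_coset_rep])

lemma mrc_proj_nat: "tam_nat G T (tam_MRC G T) (mrc_proj G T)"
proof -
  have "tam_nat G T (tam_MRC G T) (\<lambda>X a. coset_rep (zero_coset G T X a))"
    unfolding tam_MRC_def by (rule tam_nat_compose[OF quotient_nat transport_nat[OF inj_coset_rep]])
  then show ?thesis
    by (simp add: mrc_proj_def[abs_def])
qed

lemma mrc_proj_surj: "mrc_proj G T X ` val T X = val (tam_MRC G T) X"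
  by (simp add: tam_MRC_def transport_def val_quotient mrc_proj_def image_image)

end

lemma tam_nat_free_eq:
  assumes q: "tam_nat G T S q" and X: "fin_gset G X" and ab: "a \<in> val T X" "b \<in> val T X"
    and eq: "free_eq G (res T) X a b"
  shows "free_eq G (res S) X (q X a) (q X b)"
  using eq ab X unfolding free_eq_def by (metis is_G_mod_e_def tam_natD(2)[OF q])

section \<open>Morphisms\<close>

lemma tam_hom_nat: "\<phi> \<in> tam_hom G T S \<Longrightarrow> tam_nat G T S \<phi>"
  by (auto simp: tam_hom_def tam_nat_def ring_hom_def tam_ring_def)

lemma tam_hom_eqI:
  fixes T :: "('g, 'x, 'u) tambara" and S :: "('g, 'x, 'v) tambara"
  assumes "\<phi> \<in> tam_hom G T S" "\<psi> \<in> tam_hom G T S"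
    and "\<And>X a. \<lbrakk>fin_gset G X; a \<in> val T X\<rbrakk> \<Longrightarrow> \<phi> X a = \<psi> X a"
  shows "\<phi> = \<psi>"
proof (rule extensionalityI)
  show "\<phi> \<in> extensional (Collect (fin_gset G))" "\<psi> \<in> extensional (Collect (fin_gset G))"
    using assms(1,2) by (auto simp: tam_hom_def)
  fix X :: "('g, 'x) gset"
  assume "X \<in> Collect (fin_gset G)"
  then show "\<phi> X = \<psi> X"
    using assms by (intro extensionalityI[of _ "val T X"]) (auto simp: tam_hom_def)
qed

lemma full_subcategory_is_category:
  assumes "is_category C"
  shows "is_category (full_subcategory C P)"
  using assms unfolding is_category_def full_subcategory_def
  by (elim conjE, intro conjI ballI) simp_all

lemma tam_comp_apply:
  "\<lbrakk>fin_gset G X; a \<in> val T X\<rbrakk> \<Longrightarrow> Comp (Tam G) T S R \<psi> \<phi> X a = \<psi> X (\<phi> X a)"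
  by (simp add: Tam_def compose_eq)

lemma tam_id_apply: "\<lbrakk>fin_gset G X; a \<in> val T X\<rbrakk> \<Longrightarrow> Id (Tam G) T X a = a"
  by (simp add: Tam_def)

lemma tam_hom_closed: "\<lbrakk>\<phi> \<in> tam_hom G T S; fin_gset G X; a \<in> val T X\<rbrakk> \<Longrightarrow> \<phi> X a \<in> val S X"
  by (rule tam_natD(1)[OF tam_hom_nat])

lemma Obj_Tam: "Obj (Tam G) = Collect (tambara_functor G)" and Hom_Tam: "Hom (Tam G) = tam_hom G"
  by (simp_all add: Tam_def)

lemma Obj_TamMRC: "Obj (TamMRC G) = {T. tambara_functor G T \<and> MRC G T}"
  and Hom_TamMRC: "Hom (TamMRC G) = tam_hom G"
  and Comp_TamMRC: "Comp (TamMRC G) = Comp (Tam G)"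
  and Id_TamMRC: "Id (TamMRC G) = Id (Tam G)"
  by (simp_all add: TamMRC_def full_subcategory_def Tam_def)

section \<open>The category, the functor and the adjunction\<close>

context
  fixes G :: "('g, 'b) monoid_scheme"
  assumes group: "group G" and fin: "finite (carrier G)"
begin

text \<open>Cutting a natural family down to its domains supplies the extensionality that
  \<open>tam_hom\<close> demands; the ring conditions follow from naturality.\<close>

lemma tam_hom_restrictI:
  fixes T :: "('g, 'x::infinite, 'u) tambara" and S :: "('g, 'x, 'v) tambara"
  assumes T: "tambara_functor G T" and S: "tambara_functor G S" and q: "tam_nat G T S q"
  shows "(\<lambda>X\<in>Collect (fin_gset G). \<lambda>a\<in>val T X. q X a) \<in> tam_hom G T S"
proof -
  let ?q = "\<lambda>X\<in>Collect (fin_gset G). \<lambda>a\<in>val T X. q X a"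
  have nat: "tam_nat G T S ?q"
    using q by (auto simp: tam_nat_def tambara_closed[OF T])
  show ?thesis
    unfolding tam_hom_def
    using tam_nat_ring_hom[OF fin T S nat] nat unfolding tam_nat_def by simp
qed

lemma tam_hom_comp:
  fixes T S R :: "('g, 'x::infinite, 'u) tambara"
  assumes T: "tambara_functor G T" and R: "tambara_functor G R"
    and \<phi>: "\<phi> \<in> tam_hom G T S" and \<psi>: "\<psi> \<in> tam_hom G S R"
  shows "Comp (Tam G) T S R \<psi> \<phi> \<in> tam_hom G T R"
  using tam_hom_restrictI[OF T R tam_nat_compose[OF tam_hom_nat[OF \<phi>] tam_hom_nat[OF \<psi>]]]
  by (simp add: Tam_def compose_def)

lemma tam_id_hom:
  fixes T :: "('g, 'x::infinite, 'u) tambara"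
  assumes T: "tambara_functor G T"
  shows "Id (Tam G) T \<in> tam_hom G T T"
  using tam_hom_restrictI[OF T T, of "\<lambda>X a. a"] by (simp add: Tam_def tam_nat_def)

lemma Tam_category: "is_category (Tam G :: ('g, 'x::infinite, 'u) tam_category)"
  unfolding is_category_def Obj_Tam Hom_Tam mem_Collect_eq Ball_Collect[symmetric]
proof (intro conjI ballI, goal_cases)
  case 1
  then show ?case by (simp add: tam_id_hom)
next
  case 2
  then show ?case by (simp add: tam_hom_comp)
next
  case (3 A B f)
  then show ?case
    by (intro tam_hom_eqI[of _ G A B] tam_hom_comp)
      (simp_all add: tam_id_hom tam_comp_apply tam_id_apply)
next
  case (4 A B f)
  then show ?case
    by (intro tam_hom_eqI[of _ G A B] tam_hom_comp)
      (simp_all add: tam_id_hom tam_comp_apply tam_id_apply tam_hom_closed)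
next
  case (5 A B D E f h k)
  then show ?case
    by (intro tam_hom_eqI[of _ G A E] tam_hom_comp)
      (simp_all add: tam_hom_comp tam_comp_apply tam_hom_closed)
qed

lemma TamMRC_category: "is_category (TamMRC G :: ('g, 'x::infinite, 'u) tam_category)"
  unfolding TamMRC_def by (rule full_subcategory_is_category[OF Tam_category])

lemma finite_tambaraI: "tambara_functor G T \<Longrightarrow> finite_tambara G T"
  using group fin by (simp add: finite_tambara_def finite_tambara_axioms_def)

text \<open>Naturality of the unit. The projections being surjective, this equation fixes all values
  of \<open>tam_MRC_map\<close>, and the functor laws are derived from it.\<close>

lemma tam_MRC_map_proj:
  fixes T S :: "('g, 'x::infinite, 'u) tambara"
  assumes T: "tambara_functor G T" and S: "tambara_functor G S" and \<phi>: "\<phi> \<in> tam_hom G T S"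
    and X: "fin_gset G X" and a: "a \<in> val T X"
  shows "tam_MRC_map G T S \<phi> X (mrc_proj G T X a) = mrc_proj G S X (\<phi> X a)"
proof -
  interpret T: finite_tambara G T by (rule finite_tambaraI[OF T])
  interpret S: finite_tambara G S by (rule finite_tambaraI[OF S])
  have "mrc_proj G T X a \<in> val (tam_MRC G T) X"
    using a by (auto simp flip: T.mrc_proj_surj)
  moreover have "inv_into (val T.Q X) coset_rep (mrc_proj G T X a) = zero_coset G T X a"
    using T.inj_coset_rep[OF X] a by (simp add: mrc_proj_def T.val_quotient)
  moreover have "induced (tam_ring G S X) (ideal_zero G S X) (\<phi> X) (zero_coset G T X a) =
      zero_coset G S X (\<phi> X a)"
    using tam_nat_free_eq[OF tam_hom_nat[OF \<phi>] X _ a] a X \<phi>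
    by (intro T.induced_zero_coset) (simp_all add: S.zero_coset_eq_iff tam_hom_closed T.eqv_sym)
  ultimately show ?thesis
    using X by (simp add: tam_MRC_map_def mrc_proj_def)
qed

lemma tam_MRC_map_hom:
  fixes T S :: "('g, 'x::infinite, 'u) tambara"
  assumes T: "tambara_functor G T" and S: "tambara_functor G S" and \<phi>: "\<phi> \<in> tam_hom G T S"
  shows "tam_MRC_map G T S \<phi> \<in> tam_hom G (tam_MRC G T) (tam_MRC G S)"
proof -
  interpret T: finite_tambara G T by (rule finite_tambaraI[OF T])
  interpret S: finite_tambara G S by (rule finite_tambaraI[OF S])
  have "tam_nat G (tam_MRC G T) (tam_MRC G S) (tam_MRC_map G T S \<phi>)"
    using tam_nat_compose[OF tam_hom_nat[OF \<phi>] S.mrc_proj_nat]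
    by (rule tam_nat_factor[OF T T.mrc_proj_nat T.mrc_proj_surj]) (rule tam_MRC_map_proj[OF T S \<phi>])
  \<comment> \<open>\<open>tam_MRC_map\<close> is already extensional on both levels, so cutting it
    down again changes nothing.\<close>
  from tam_hom_restrictI[OF T.tambara_MRC S.tambara_MRC this] show ?thesis
    by (simp add: tam_MRC_map_def cong: restrict_cong)
qed

text \<open>Surjectivity makes the projection an epimorphism: morphisms out of
  \<open>tam_MRC G T\<close> may be compared after precomposing with it.\<close>

lemma tam_MRC_hom_eqI:
  fixes T S :: "('g, 'x::infinite, 'u) tambara"
  assumes T: "tambara_functor G T"
    and "\<phi> \<in> tam_hom G (tam_MRC G T) S" "\<psi> \<in> tam_hom G (tam_MRC G T) S"
    and eq: "\<And>X a. \<lbrakk>fin_gset G X; a \<in> val T X\<rbrakk> \<Longrightarrow> \<phi> X (mrc_proj G T X a) = \<psi> X (mrc_proj G T X a)"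
  shows "\<phi> = \<psi>"
proof (rule tam_hom_eqI[OF assms(2,3)])
  fix X :: "('g, 'x) gset" and a
  assume X: "fin_gset G X" and "a \<in> val (tam_MRC G T) X"
  then obtain b where "b \<in> val T X" "a = mrc_proj G T X b"
    unfolding finite_tambara.mrc_proj_surj[OF finite_tambaraI[OF T], symmetric] by blast
  then show "\<phi> X a = \<psi> X a"
    using eq[OF X] by simp
qed

lemma mrc_proj_closed:
  fixes T :: "('g, 'x::infinite, 'u) tambara"
  shows "\<lbrakk>tambara_functor G T; fin_gset G X; a \<in> val T X\<rbrakk> \<Longrightarrow> mrc_proj G T X a \<in> val (tam_MRC G T) X"
  by (rule tam_natD(1)[OF finite_tambara.mrc_proj_nat[OF finite_tambaraI]])

lemma MRC_is_functor:
  "is_functor (Tam G :: ('g, 'x::infinite, 'u) tam_category) (TamMRC G) (MRC_functor G)"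
  unfolding is_functor_def Obj_TamMRC Hom_TamMRC Comp_TamMRC Id_TamMRC Obj_Tam Hom_Tam MRC_functor_def
    cat_functor.simps mem_Collect_eq
proof (intro conjI ballI Tam_category TamMRC_category, unfold mem_Collect_eq, goal_cases)
  case (1 T)
  then show ?case by (rule finite_tambara.tambara_MRC[OF finite_tambaraI])
next
  case (2 T)
  then show ?case by (rule finite_tambara.MRC_MRC[OF finite_tambaraI])
next
  case (3 T S \<phi>)
  then show ?case by (rule tam_MRC_map_hom)
next
  case T: (4 T)
  interpret T: finite_tambara G T by (rule finite_tambaraI[OF T])
  show ?case
    by (rule tam_MRC_hom_eqI[OF T tam_MRC_map_hom[OF T T tam_id_hom[OF T]] tam_id_hom[OF T.tambara_MRC]])
      (simp add: tam_MRC_map_proj[OF T T tam_id_hom[OF T]] tam_id_apply mrc_proj_closed[OF T])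
next
  case (5 T S R \<phi> \<psi>)
  interpret R: finite_tambara G R by (rule finite_tambaraI[OF 5(3)])
  interpret T: finite_tambara G T by (rule finite_tambaraI[OF 5(1)])
  note c = tam_hom_comp[OF 5(1) 5(3) 5(4) 5(5)]
  note m = tam_MRC_map_hom[OF 5(1) 5(2) 5(4)] tam_MRC_map_hom[OF 5(2) 5(3) 5(5)]
  show ?case
    by (rule tam_MRC_hom_eqI[OF 5(1) tam_MRC_map_hom[OF 5(1) 5(3) c] tam_hom_comp[OF T.tambara_MRC R.tambara_MRC m]])
      (simp add: tam_MRC_map_proj[OF 5(1) 5(3) c] tam_MRC_map_proj[OF 5(1) 5(2) 5(4)]
        tam_MRC_map_proj[OF 5(2) 5(3) 5(5)] tam_comp_apply mrc_proj_closed[OF 5(1)] tam_hom_closed[OF 5(4)])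
qed

lemma inclusion_is_functor:
  "is_functor (TamMRC G :: ('g, 'x::infinite, 'u) tam_category) (Tam G) inclusion_functor"
  using Tam_category TamMRC_category
  by (auto simp: is_functor_def inclusion_functor_def Obj_TamMRC Hom_TamMRC Comp_TamMRC Id_TamMRC Obj_Tam Hom_Tam)

lemma mrc_proj_hom:
  fixes T :: "('g, 'x::infinite, 'u) tambara"
  assumes T: "tambara_functor G T"
  shows "(\<lambda>X\<in>Collect (fin_gset G). \<lambda>a\<in>val T X. mrc_proj G T X a) \<in> tam_hom G T (tam_MRC G T)"
proof -
  interpret T: finite_tambara G T by (rule finite_tambaraI[OF T])
  show ?thesis
    by (rule tam_hom_restrictI[OF T T.tambara_MRC T.mrc_proj_nat])
qed

text \<open>The representatives of the classes lie in \<open>T\<close> itself, so the factorization of \<open>\<phi>\<close> through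
  \<open>T\<^bsub>MRC\<^esub>\<close> is its restriction to them.\<close>

lemma mrc_proj_universal:
  fixes T S :: "('g, 'x::infinite, 'u) tambara"
  assumes T: "tambara_functor G T" and S: "tambara_functor G S" and MRC: "MRC G S"
    and \<phi>: "\<phi> \<in> tam_hom G T S"
  obtains \<psi> where "\<psi> \<in> tam_hom G (tam_MRC G T) S"
    "\<And>X a. \<lbrakk>fin_gset G X; a \<in> val T X\<rbrakk> \<Longrightarrow> \<psi> X (mrc_proj G T X a) = \<phi> X a"
proof -
  interpret T: finite_tambara G T by (rule finite_tambaraI[OF T])
  interpret S: finite_tambara G S by (rule finite_tambaraI[OF S])
  have eq: "\<phi> X (mrc_proj G T X a) = \<phi> X a" if X: "fin_gset G X" and a: "a \<in> val T X" for X a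
  proof (rule S.add.eq_if_free_eq[OF _ X])
    show "inj_on (res S X Y f) (val S Y)"
      if "transitive_gset G X" "transitive_gset G Y" "f \<in> gmap G X Y" for X Y f
      using MRC that by (auto simp: MRC_def)
    show "free_eq G (res S) X (\<phi> X (mrc_proj G T X a)) (\<phi> X a)"
      by (rule tam_nat_free_eq[OF tam_hom_nat[OF \<phi>] X T.mrc_proj_in(1)[OF X a] a
            T.eqv_sym[OF T.mrc_proj_in(2)[OF X a]]])
  qed (use tam_hom_closed[OF \<phi> X] a T.mrc_proj_in[OF X a] in auto)
  \<comment> \<open>Here \<open>\<phi>\<close> is both the map to be factored and its factor: by
    \<open>eq\<close> it takes the same value at \<open>a\<close> and at the representative of
    \<open>a\<close>.\<close>
  have "tam_nat G (tam_MRC G T) S \<phi>"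
    using eq by (rule tam_nat_factor[OF T T.mrc_proj_nat T.mrc_proj_surj tam_hom_nat[OF \<phi>]])
  from tam_hom_restrictI[OF T.tambara_MRC S this] show thesis
    by (rule that) (simp add: mrc_proj_closed[OF T] eq)
qed

text \<open>The bijection is precomposition with the unit: injective because the unit is epic,
  surjective by its universal property.\<close>

lemma MRC_left_adjoint:
  "is_left_adjoint (Tam G :: ('g, 'x::infinite, 'u) tam_category) (TamMRC G)
     (MRC_functor G) inclusion_functor"
proof -
  let ?\<eta> = "\<lambda>T. \<lambda>X\<in>Collect (fin_gset G). \<lambda>a\<in>val T X. mrc_proj G T X a"
  let ?\<Phi> = "\<lambda>T S \<psi>. Comp (Tam G) T (tam_MRC G T) S \<psi> (?\<eta> T)"
  have bij: "bij_betw (?\<Phi> T S) (tam_hom G (tam_MRC G T) S) (tam_hom G T S)"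
    if T: "tambara_functor G T" and S: "tambara_functor G S" and MRC: "MRC G S"
    for T S :: "('g, 'x, 'u) tambara"
    unfolding bij_betw_def
  proof
    have app: "?\<Phi> T S \<psi> X a = \<psi> X (mrc_proj G T X a)" if "fin_gset G X" "a \<in> val T X" for \<psi> X a
      using that by (simp add: tam_comp_apply)
    show "inj_on (?\<Phi> T S) (tam_hom G (tam_MRC G T) S)"
    proof (rule inj_onI)
      fix \<psi> \<psi>'
      assume "\<psi> \<in> tam_hom G (tam_MRC G T) S" "\<psi>' \<in> tam_hom G (tam_MRC G T) S" "?\<Phi> T S \<psi> = ?\<Phi> T S \<psi>'"
      then show "\<psi> = \<psi>'"
        by (intro tam_MRC_hom_eqI[OF T]) (simp_all flip: app)
    qed
    show "?\<Phi> T S ` tam_hom G (tam_MRC G T) S = tam_hom G T S"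
    proof
      show "?\<Phi> T S ` tam_hom G (tam_MRC G T) S \<subseteq> tam_hom G T S"
        using tam_hom_comp[OF T S mrc_proj_hom[OF T]] by blast
      show "tam_hom G T S \<subseteq> ?\<Phi> T S ` tam_hom G (tam_MRC G T) S"
      proof
        fix \<phi>
        assume \<phi>: "\<phi> \<in> tam_hom G T S"
        then obtain \<psi> where \<psi>: "\<psi> \<in> tam_hom G (tam_MRC G T) S"
          and eq: "\<And>X a. \<lbrakk>fin_gset G X; a \<in> val T X\<rbrakk> \<Longrightarrow> \<psi> X (mrc_proj G T X a) = \<phi> X a"
          using mrc_proj_universal[OF T S MRC] by metis
        have "\<phi> = ?\<Phi> T S \<psi>"
          by (rule tam_hom_eqI[OF \<phi> tam_hom_comp[OF T S mrc_proj_hom[OF T] \<psi>]]) (simp add: app eq)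
        then show "\<phi> \<in> ?\<Phi> T S ` tam_hom G (tam_MRC G T) S"
          using \<psi> by (rule image_eqI)
      qed
    qed
  qed
  \<comment> \<open>At \<open>a\<close>, both sides apply \<open>\<psi>\<close> and then
    \<open>k\<close> to the projection of \<open>f X a\<close>; what has to be known is naturality
    of the unit.\<close>
  have nat: "?\<Phi> T' S' (Comp (Tam G) (tam_MRC G T') S S' k
        (Comp (Tam G) (tam_MRC G T') (tam_MRC G T) S \<psi> (tam_MRC_map G T' T f))) =
      Comp (Tam G) T' S S' k (Comp (Tam G) T' T S (?\<Phi> T S \<psi>) f)"
    if T: "tambara_functor G T" "tambara_functor G T'" and S: "tambara_functor G S" "tambara_functor G S'"
      and f: "f \<in> tam_hom G T' T" and k: "k \<in> tam_hom G S S'" and \<psi>: "\<psi> \<in> tam_hom G (tam_MRC G T) S"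
    for T T' S S' :: "('g, 'x, 'u) tambara" and f k \<psi>
  proof (rule tam_hom_eqI)
    have m: "tambara_functor G (tam_MRC G T')"
      using finite_tambara.tambara_MRC[OF finite_tambaraI[OF T(2)]] .
    show "?\<Phi> T' S' (Comp (Tam G) (tam_MRC G T') S S' k
        (Comp (Tam G) (tam_MRC G T') (tam_MRC G T) S \<psi> (tam_MRC_map G T' T f))) \<in> tam_hom G T' S'"
      by (intro tam_hom_comp mrc_proj_hom T S m k \<psi> tam_MRC_map_hom f)
    show "Comp (Tam G) T' S S' k (Comp (Tam G) T' T S (?\<Phi> T S \<psi>) f) \<in> tam_hom G T' S'"
      by (intro tam_hom_comp[OF _ _ _ k] tam_hom_comp[OF _ _ f] tam_hom_comp[OF _ _ _ \<psi>] mrc_proj_hom T S)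
  qed (simp add: tam_comp_apply mrc_proj_closed[OF T(2)] tam_MRC_map_proj[OF T(2) T(1) f] tam_hom_closed[OF f])
  show ?thesis
    unfolding is_left_adjoint_def
  proof (intro conjI MRC_is_functor inclusion_is_functor exI[of _ ?\<Phi>])
  qed (use bij nat in \<open>simp_all add: Obj_TamMRC Hom_TamMRC Comp_TamMRC Obj_Tam Hom_Tam MRC_functor_def
      inclusion_functor_def\<close>)
qed

end

text \<open>The first conjunct covers the literal quotient, whose values are sets of cosets, as well
  as its copy on representatives, which is the object that the functor returns.\<close>

theorem theorem4p24:
  fixes G :: "('g, 'b) monoid_scheme"
  assumes "group G" and "finite (carrier G)"
  shows
    "(\<forall>T \<in> Obj (Tam G :: ('g, 'x::infinite, 'u) tam_category).
        tam_quotient G T (ideal_zero G T) \<in> Obj (TamMRC G) \<and> tam_MRC G T \<in> Obj (TamMRC G)) \<and>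
     is_functor (Tam G :: ('g, 'x, 'u) tam_category) (TamMRC G) (MRC_functor G) \<and>
     is_left_adjoint (Tam G :: ('g, 'x, 'u) tam_category) (TamMRC G)
       (MRC_functor G) inclusion_functor"
proof (intro conjI ballI)
  fix T :: "('g, 'x, 'u) tambara"
  assume "T \<in> Obj (Tam G)"
  then interpret finite_tambara G T
    using assms by (intro finite_tambaraI) (simp_all add: Obj_Tam)
  show "tam_quotient G T (ideal_zero G T) \<in> Obj (TamMRC G)"
    using tambara_quotient MRC_quotient by (simp add: Obj_TamMRC)
  show "tam_MRC G T \<in> Obj (TamMRC G)"
    using tambara_MRC MRC_MRC by (simp add: Obj_TamMRC)
qed (rule MRC_is_functor[OF assms] MRC_left_adjoint[OF assms])+

end
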